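(* Assume $\mathrm{char}(F)=0$ or $\mathrm{char}(F)>2$. Let $\gamma\in\mathfrak{gl}_2(\mathfrak{o})$ be a hyperbolic regular semisimple element, i.e. $\chi_\gamma(x)$ is a product of two distinct monic linear polynomials over $F$. Then $\mathcal{SO}_\gamma=\frac{q+1}{q}$.
   Context: $F$ is a non-Archimedean local field, $\mathfrak{o}$ its ring of integers, $\pi$ a uniformizer, $\kappa$ the residue field, $q=\#\kappa$. For $\gamma\in\mathfrak{gl}_n(\mathfrak{o})$ write $\chi_\gamma(x)=x^n+c_1x^{n-1}+\dots+c_n$ for its characteristic polynomial; regular semisimple means $\chi_\gamma$ separable. Let $\varphi_n:\mathfrak{gl}_{n,\mathfrak{o}}\to\mathbb{A}^n_{\mathfrak{o}}$ send a matrix to $(c_1,\dots,c_n)$, with generic fiber $\rho_n$. Let $\omega_{\mathfrak{gl}}$, $\omega_{\mathbb{A}}$ be translation-invariant top forms on $\mathfrak{gl}_{n,F}$, $\mathbb{A}^n_F$ with $\mathfrak{gl}_n(\mathfrak{o})$, $\mathbb{A}^n(\mathfrak{o})$ of volume $1$; on the smooth fiber $\rho_n^{-1}(\chi_\gamma)$ let $\omega^{\mathrm{ld}}_{\chi_\gamma}=\omega_{\mathfrak{gl}}/\rho_n^*\omega_{\mathbb{A}}$ be the quotient form. Then $\mathcal{SO}_\gamma=\int_{\{X\in\mathfrak{gl}_n(\mathfrak{o}):\chi_X=\chi_\gamma\}}|\omega^{\mathrm{ld}}_{\chi_\gamma}|$. *)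

theory Defs
  imports "HOL-Analysis.Analysis" "HOL-Computational_Algebra.Computational_Algebra"
begin

section \<open>Non-Archimedean local fields\<close>

text \<open>The value of \<open>val\<close> at \<open>0\<close> is irrelevant: \<open>val 0 = \<infinity>\<close> is always treated separately.
  Surjectivity of \<open>val\<close> is expressed by the existence of a uniformizer.\<close>

class discretely_valued_field = field +
  fixes val :: "'a \<Rightarrow> int"
  assumes val_mult: "x \<noteq> 0 \<Longrightarrow> y \<noteq> 0 \<Longrightarrow> val (x * y) = val x + val y"
    and val_add: "x \<noteq> 0 \<Longrightarrow> y \<noteq> 0 \<Longrightarrow> x + y \<noteq> 0 \<Longrightarrow> min (val x) (val y) \<le> val (x + y)"
    and ex_uniformizer: "\<exists>x. x \<noteq> 0 \<and> val x = 1"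
begin

definition ring_of_integers :: "'a set" where
  "ring_of_integers = {x. x = 0 \<or> 0 \<le> val x}"

definition maximal_ideal :: "'a set" where
  "maximal_ideal = {x. x = 0 \<or> 1 \<le> val x}"

definition residue_field :: "'a set set" where
  "residue_field = ring_of_integers //
     {(x, y). x \<in> ring_of_integers \<and> y \<in> ring_of_integers \<and> x - y \<in> maximal_ideal}"

definition absval :: "'a \<Rightarrow> real" where
  "absval x = (if x = 0 then 0 else real (card residue_field) powi (- val x))"

end

class nonarch_local_field = discretely_valued_field + complete_space +
  assumes finite_residue_field: "finite residue_field"
    and dist_absval: "dist x y = absval (x - y)"

text \<open>The Haar measure on the additive group of the field giving the ring of integers volume
  \<open>1\<close>, and the corresponding product measure on the coordinate space indexed by \<open>'k\<close>.\<close>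

definition normalized_haar_measure :: "'a::nonarch_local_field measure \<Rightarrow> bool" where
  "normalized_haar_measure \<mu> \<longleftrightarrow> sets \<mu> = sets borel \<and>
     (\<forall>a. \<forall>A\<in>sets borel. emeasure \<mu> ((+) a ` A) = emeasure \<mu> A) \<and>
     emeasure \<mu> ring_of_integers = 1"

definition coordinate_measure ::
    "'a::nonarch_local_field measure \<Rightarrow> ('a ^ 'k::finite) measure" where
  "coordinate_measure \<mu> = distr (\<Pi>\<^sub>M i\<in>(UNIV::'k set). \<mu>) borel vec_lambda"

definition integral_points :: "('a::discretely_valued_field ^ 'm::finite) set" where
  "integral_points = {x. \<forall>i. x $ i \<in> ring_of_integers}"


section \<open>Analytic charts\<close>

definition has_jacobian ::
    "('a::nonarch_local_field ^ 'k::finite \<Rightarrow> 'a ^ 'm::finite) \<Rightarrow> 'a ^ 'k ^ 'm \<Rightarrow> 'a ^ 'k \<Rightarrow> bool" where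
  "has_jacobian f D x \<longleftrightarrow> ((\<lambda>y. dist (f y) (f x + D *v (y - x)) / dist y x) \<longlongrightarrow> 0) (at x)"

definition jacobian ::
    "('a::nonarch_local_field ^ 'k::finite \<Rightarrow> 'a ^ 'm::finite) \<Rightarrow> 'a ^ 'k \<Rightarrow> 'a ^ 'k ^ 'm" where
  "jacobian f x = (THE D. has_jacobian f D x)"

text \<open>Every component is given near \<open>s\<close> by a convergent power series in the coordinates centred
  at \<open>s\<close>; the multi-indices are the functions \<open>'k \<Rightarrow> nat\<close>.\<close>

definition analytic_at ::
    "('a::nonarch_local_field ^ 'k::finite \<Rightarrow> 'a ^ 'm::finite) \<Rightarrow> 'a ^ 'k \<Rightarrow> bool" where
  "analytic_at f s \<longleftrightarrow> (\<forall>i. \<exists>c :: ('k \<Rightarrow> nat) \<Rightarrow> 'a.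
     \<forall>\<^sub>F t in nhds s. ((\<lambda>\<alpha>. c \<alpha> * (\<Prod>j\<in>UNIV. (t $ j - s $ j) ^ \<alpha> j)) has_sum f t $ i) UNIV)"

text \<open>An inverse chart: an analytic immersion \<open>\<psi>\<close> that maps the open set \<open>V\<close> of the coordinate space
  homeomorphically onto an open subset of the submanifold \<open>M\<close>.\<close>

definition chart_on ::
    "('a::nonarch_local_field ^ 'm::finite) set \<Rightarrow> ('a ^ 'k::finite) set \<Rightarrow> ('a ^ 'k \<Rightarrow> 'a ^ 'm) \<Rightarrow> bool" where
  "chart_on M V \<psi> \<longleftrightarrow> open V \<and>
     (\<forall>t\<in>V. analytic_at \<psi> t \<and> inj ((*v) (jacobian \<psi> t))) \<and>
     openin (top_of_set M) (\<psi> ` V) \<and> (\<exists>g. homeomorphism V (\<psi> ` V) \<psi> g)"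


section \<open>Differential forms and the measures attached to them\<close>

text \<open>A differential form on a submanifold \<open>M\<close> of an affine space is a map \<open>\<omega>\<close> such that
  \<open>\<omega> X u\<close> is its value at the point \<open>X\<close> on the family \<open>u\<close> of tangent vectors.
  \<open>form_measure \<mu> M \<omega> \<nu>\<close> says that \<open>\<nu>\<close> is the measure on \<open>M\<close> usually written as the absolute value
  of the top form \<open>\<omega>\<close>: if \<open>\<omega>\<close> pulls back to \<open>f dt\<^sub>1 \<and> \<dots> \<and> dt\<^sub>k\<close> in a chart, then
  \<open>\<nu>\<close> is given there by the density \<open>\<bar>f\<bar>\<close> with respect to \<open>dt\<^sub>1 \<dots> dt\<^sub>k\<close>.\<close>

definition form_measure ::
    "'a::nonarch_local_field measure \<Rightarrow> ('a ^ 'm::finite) set \<Rightarrow>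
     ('a ^ 'm \<Rightarrow> ('k::finite \<Rightarrow> 'a ^ 'm) \<Rightarrow> 'a) \<Rightarrow> ('a ^ 'm) measure \<Rightarrow> bool" where
  "form_measure \<mu> M \<omega> \<nu> \<longleftrightarrow> sets \<nu> = sets (restrict_space borel M) \<and>
     (\<forall>V (\<psi> :: 'a ^ 'k \<Rightarrow> 'a ^ 'm). chart_on M V \<psi> \<longrightarrow>
       (\<forall>A\<in>sets \<nu>. A \<subseteq> \<psi> ` V \<longrightarrow>
         emeasure \<nu> A = (\<integral>\<^sup>+t\<in>{t\<in>V. \<psi> t \<in> A}.
           ennreal (absval (\<omega> (\<psi> t) (\<lambda>j. column j (jacobian \<psi> t)))) \<partial>coordinate_measure \<mu>)))"

definition alternating_form ::
    "(('k::finite \<Rightarrow> 'a::field ^ 'm::finite) \<Rightarrow> 'a) \<Rightarrow> bool" where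
  "alternating_form \<omega> \<longleftrightarrow>
     (\<forall>v i x y. \<omega> (v(i := x + y)) = \<omega> (v(i := x)) + \<omega> (v(i := y))) \<and>
     (\<forall>v i a x. \<omega> (v(i := a *s x)) = a * \<omega> (v(i := x))) \<and>
     (\<forall>v i j. i \<noteq> j \<longrightarrow> v i = v j \<longrightarrow> \<omega> v = 0)"

text \<open>A translation-invariant top form on an affine space is the same as one alternating form on
  its space of translations.\<close>

definition unit_volume_form ::
    "'a::nonarch_local_field measure \<Rightarrow> (('k::finite \<Rightarrow> 'a ^ 'm::finite) \<Rightarrow> 'a) \<Rightarrow> bool" where
  "unit_volume_form \<mu> \<omega> \<longleftrightarrow> CARD('k) = CARD('m) \<and> alternating_form \<omega> \<and>
     (\<exists>\<nu>. form_measure \<mu> UNIV (\<lambda>_. \<omega>) \<nu> \<and> emeasure \<nu> integral_points = 1)"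

text \<open>The form \<open>\<omega>\<close> on the fibres of \<open>f\<close> with \<open>\<omega>\<^sub>V = \<omega> \<and> f\<^sup>* \<omega>\<^sub>W\<close>. Since \<open>f\<^sup>* \<omega>\<^sub>W\<close> vanishes as
  soon as one argument is tangent to the fibre, for tangent vectors \<open>u\<close> of the fibre this
  identity reads \<open>\<omega>\<^sub>V (u, v) = \<omega> u * \<omega>\<^sub>W (df v)\<close> for all \<open>v\<close>, which determines \<open>\<omega> u\<close>
  wherever \<open>f\<close> is a submersion.\<close>

definition quotient_form ::
    "('a::nonarch_local_field ^ 'm::finite \<Rightarrow> 'a ^ 'n::finite) \<Rightarrow> (('k + 'l \<Rightarrow> 'a ^ 'm) \<Rightarrow> 'a) \<Rightarrow>
     (('l \<Rightarrow> 'a ^ 'n) \<Rightarrow> 'a) \<Rightarrow> 'a ^ 'm \<Rightarrow> ('k \<Rightarrow> 'a ^ 'm) \<Rightarrow> 'a" where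
  "quotient_form f \<omega>\<^sub>V \<omega>\<^sub>W X u =
     (THE c. \<forall>v. \<omega>\<^sub>V (case_sum u v) = c * \<omega>\<^sub>W (\<lambda>i. jacobian f X *v v i))"


section \<open>Characteristic polynomials and orbital integrals\<close>

definition charpoly :: "'a::comm_ring_1 ^ 'n ^ 'n::finite \<Rightarrow> 'a poly" where
  "charpoly X = det (mat [:0, 1:] - map_matrix (\<lambda>a. [:a:]) X)"

definition integral_matrices :: "('a::discretely_valued_field ^ 'n::finite ^ 'n) set" where
  "integral_matrices = {X. \<forall>i j. X $ i $ j \<in> ring_of_integers}"

text \<open>Matrices as points of the affine space whose coordinates are the matrix entries.\<close>

definition matrix_point :: "'a ^ 'n ^ 'm \<Rightarrow> 'a ^ ('m::finite \<times> 'n::finite)" where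
  "matrix_point X = (\<chi> p. X $ fst p $ snd p)"

definition point_matrix :: "'a ^ ('m::finite \<times> 'n::finite) \<Rightarrow> 'a ^ 'n ^ 'm" where
  "point_matrix x = (\<chi> i j. x $ (i, j))"

definition char_map :: "'a::comm_ring_1 ^ (2 \<times> 2) \<Rightarrow> 'a ^ 2" where
  "char_map x = vector [coeff (charpoly (point_matrix x)) 1, coeff (charpoly (point_matrix x)) 0]"

definition char_fiber :: "'a::comm_ring_1 ^ 2 ^ 2 \<Rightarrow> ('a ^ (2 \<times> 2)) set" where
  "char_fiber \<gamma> = {x. char_map x = char_map (matrix_point \<gamma>)}"

definition hyperbolic_regular_semisimple :: "'a::field ^ 2 ^ 2 \<Rightarrow> bool" where
  "hyperbolic_regular_semisimple \<gamma> \<longleftrightarrow>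
     (\<exists>a b. a \<noteq> b \<and> charpoly \<gamma> = [:- a, 1:] * [:- b, 1:])"

text \<open>The integral over the integral matrices in the fibre; \<open>\<nu>\<close> is to be the measure on the fibre
  attached to the quotient form.\<close>

definition stable_orbital_integral ::
    "('a::nonarch_local_field ^ (2 \<times> 2)) measure \<Rightarrow> 'a ^ 2 ^ 2 \<Rightarrow> ennreal" where
  "stable_orbital_integral \<nu> \<gamma> =
     (\<integral>\<^sup>+x\<in>matrix_point ` {X \<in> integral_matrices. charpoly X = charpoly \<gamma>}. 1 \<partial>\<nu>)"

end

theory Submission
  imports Defs
begin

text \<open>A matrix \<open>X\<close> of the fibre has the distinct eigenvalues \<open>a\<close> and \<open>b\<close>, and sending it to its
  \<open>a\<close>-eigenspace makes the fibre an affine line bundle over the projective line. Over the lines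
  spanned by \<open>(1, s)\<close> the fibre is parametrized by polynomials in \<open>s\<close> and the upper right entry \<open>y\<close>
  of \<open>X\<close>, and in these coordinates the quotient form is \<open>ds \<and> dy\<close> up to a factor of
  absolute value one. The projective line is the disjoint union of the lines \<open>(1, s)\<close> with \<open>s\<close>
  integral and the lines \<open>(s, 1)\<close> with \<open>s\<close> in the maximal ideal. Over such a line \<open>X\<close> is integral if
  and only if \<open>y\<close> (respectively the lower left entry) is. Hence the integral points have volume
  \<open>1 + 1 / q\<close>.\<close>

text \<open>The measure \<open>\<nu>\<close> is prescribed only on sets inside the image of a single
  chart, so the integral points have to be cut into finitely many disjoint measurable chart images.
  Two points decide whether this works. First, no single ratio of entries recovers the eigenline:
  \<open>X - b\<close> has rank one with image the \<open>a\<close>-eigenline, so \<open>s\<close>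
  is the ratio of the lower to the upper entry in whichever column of \<open>X - b\<close> is
  nonzero, and both columns must be allowed. Second, the density must not depend on
  \<open>a - b\<close>: at s = y = 0 the transversal Jacobian of the characteristic map contributes
  a factor \<open>b - a\<close>, but so do the tangent vectors of the parametrization, and the two
  cancel exactly. The forms on the two affine spaces are given only through the volume of the
  integral points; since alternating top forms are unique up to a scalar, they are the standard
  determinants up to a factor of absolute value one. The value 1 + 1/q = (q + 1)/q reflects the q +
  1 residue discs of the projective line, each of volume 1/q.\<close>

no_notation fps_nth (infixl \<open>$\<close> 75)

section \<open>The absolute value\<close>

lemma val_1 [simp]: "val (1 :: 'a::discretely_valued_field) = 0"
  using val_mult[of "1::'a" 1] by simp

lemma val_minus [simp]: "val (- x :: 'a::discretely_valued_field) = val x"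
proof (cases "x = 0")
  case False
  have "val (- 1 :: 'a) = 0"
    using val_mult[of "-1::'a" "-1"] by simp
  with False show ?thesis
    using val_mult[of "-1" x] by simp
qed simp

text \<open>The ring of integers absorbs addition of elements of the maximal ideal, so a residue
  class is a full translate of that ideal. In this form translation invariance of the measure
  applies to it.\<close>

lemma residue_class:
  fixes x :: "'a::discretely_valued_field"
  assumes "x \<in> ring_of_integers"
  shows "{(x, y). x \<in> ring_of_integers \<and> y \<in> ring_of_integers \<and> x - y \<in> maximal_ideal} `` {x}
    = (+) x ` maximal_ideal"
proof -
  have "x + m \<in> ring_of_integers" if "m \<in> maximal_ideal" for m
    using assms that val_add[of x m] by (fastforce simp: ring_of_integers_def maximal_ideal_def)
  moreover have "- m \<in> maximal_ideal" if "m \<in> maximal_ideal" for m :: 'a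
    using that by (simp add: maximal_ideal_def)
  ultimately show ?thesis
    using assms by (auto simp: image_iff) (metis add_diff_cancel_left' diff_add_cancel minus_diff_eq add.commute)
qed

lemma residue_field_eq:
  "(residue_field :: 'a::discretely_valued_field set set)
    = (\<lambda>x. (+) x ` maximal_ideal) ` ring_of_integers"
  unfolding residue_field_def quotient_def using residue_class by blast

lemma powi_le_powi_iff:
  fixes q :: real
  assumes "q > 1"
  shows "q powi m \<le> q powi n \<longleftrightarrow> m \<le> n"
proof (cases "m \<le> n")
  case True
  with assms show ?thesis by (simp add: power_int_increasing)
next
  case False
  with assms have "q powi n < q powi m" by (intro power_int_strict_increasing) auto
  with False show ?thesis by simp
qed

text \<open>The classes of 0 and 1 differ because 1 has valuation 0. The base q > 1 makes
  \<open>absval\<close> strictly decreasing in the valuation, on which all comparisons of absolute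
  values rest.\<close>

lemma card_residue_field_ge_2: "card (residue_field :: 'a::nonarch_local_field set set) \<ge> 2"
proof -
  have "(+) 0 ` maximal_ideal \<noteq> (+) 1 ` (maximal_ideal :: 'a set)"
  proof
    assume "(+) 0 ` maximal_ideal = (+) 1 ` (maximal_ideal :: 'a set)"
    moreover have "1 + 0 \<in> (+) 1 ` (maximal_ideal :: 'a set)"
      by (rule imageI) (simp add: maximal_ideal_def)
    ultimately have "1 \<in> (maximal_ideal :: 'a set)"
      by simp
    then show False by (simp add: maximal_ideal_def)
  qed
  moreover have "0 \<in> (ring_of_integers :: 'a set)" "1 \<in> (ring_of_integers :: 'a set)"
    by (simp_all add: ring_of_integers_def)
  then have "{(+) 0 ` maximal_ideal, (+) 1 ` (maximal_ideal :: 'a set)} \<subseteq> residue_field"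
    unfolding residue_field_eq by blast
  ultimately show ?thesis
    using card_mono[OF finite_residue_field] by (metis card_2_iff)
qed

lemma card_residue_field_gt_1: "real (card (residue_field :: 'a::nonarch_local_field set set)) > 1"
  using card_residue_field_ge_2[where 'a='a] by linarith

lemma absval_0 [simp]: "absval 0 = 0"
  by (simp add: absval_def)

lemma absval_pos [simp]: "0 < absval x \<longleftrightarrow> x \<noteq> 0" for x :: "'a::nonarch_local_field"
  using card_residue_field_gt_1[where 'a='a] by (simp add: absval_def)

lemma absval_nonneg [simp]: "0 \<le> absval x" for x :: "'a::nonarch_local_field"
  by (simp add: absval_def)

lemma absval_eq_0 [simp]: "absval x = 0 \<longleftrightarrow> x = 0" for x :: "'a::nonarch_local_field"
  using absval_pos[of x] by (cases "x = 0") (auto simp del: absval_pos)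

lemma absval_1 [simp]: "absval (1 :: 'a::nonarch_local_field) = 1"
  by (simp add: absval_def)

lemma absval_mult: "absval (x * y) = absval x * absval y" for x y :: "'a::nonarch_local_field"
  using card_residue_field_gt_1[where 'a='a] val_mult[of x y]
  by (auto simp: absval_def power_int_add[symmetric])

lemma absval_minus [simp]: "absval (- x) = absval x" for x :: "'a::nonarch_local_field"
  by (simp add: absval_def)

lemma absval_minus_commute: "absval (x - y) = absval (y - x)" for x y :: "'a::nonarch_local_field"
  using absval_minus[of "x - y"] by simp

lemma absval_power: "absval (x ^ n) = absval x ^ n" for x :: "'a::nonarch_local_field"
  by (induction n) (simp_all add: absval_mult)

lemma absval_divide: "absval (x / y) = absval x / absval y" for x y :: "'a::nonarch_local_field"
  using absval_mult[of "x / y" y] by (cases "y = 0") (auto simp: field_simps)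

lemma absval_add_max: "absval (x + y) \<le> max (absval x) (absval y)"
  for x y :: "'a::nonarch_local_field"
proof (cases "x = 0 \<or> y = 0 \<or> x + y = 0")
  case False
  let ?q = "real (card (residue_field :: 'a set set))"
  have *: "absval (x + y) \<le> absval z" if "val z \<le> val (x + y)" "z \<noteq> 0" for z :: 'a
    using that False powi_le_powi_iff[OF card_residue_field_gt_1[where 'a='a]]
    by (simp add: absval_def)
  have "val x \<le> val (x + y) \<or> val y \<le> val (x + y)"
    using False val_add[of x y] by (simp add: min_le_iff_disj)
  with * False show ?thesis
    by (auto simp: le_max_iff_disj)
qed (auto simp: max_def)

lemma absval_add_le: "absval x \<le> c \<Longrightarrow> absval y \<le> c \<Longrightarrow> absval (x + y) \<le> c"
  for x y :: "'a::nonarch_local_field"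
  using absval_add_max[of x y] by linarith

lemma absval_diff_le: "absval x \<le> c \<Longrightarrow> absval y \<le> c \<Longrightarrow> absval (x - y) \<le> c"
  for x y :: "'a::nonarch_local_field"
  using absval_add_le[of x c "- y"] by simp

lemma absval_triangle: "absval (x + y) \<le> absval x + absval y" for x y :: "'a::nonarch_local_field"
  using absval_add_max[of x y] absval_nonneg[of x] absval_nonneg[of y] by linarith

text \<open>The isosceles triangle principle: a perturbation smaller than x cannot change its
  absolute value. It makes the absolute value locally constant away from 0.\<close>

lemma absval_eq_of_dist_less:
  fixes x y :: "'a::nonarch_local_field"
  assumes "absval (y - x) < absval x"
  shows "absval y = absval x"
  using assms absval_add_max[of x "y - x"] absval_add_max[of y "x - y"] absval_minus_commute[of x y]
  by (auto simp: max_def split: if_splits)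

lemma ring_of_integers_iff: "x \<in> ring_of_integers \<longleftrightarrow> absval x \<le> 1"
  for x :: "'a::nonarch_local_field"
  using powi_le_powi_iff[OF card_residue_field_gt_1[where 'a='a], of "- val x" 0]
  by (auto simp: ring_of_integers_def absval_def)

lemma maximal_ideal_iff:
  "x \<in> maximal_ideal \<longleftrightarrow> absval x \<le> inverse (real (card (residue_field :: 'a set set)))"
  for x :: "'a::nonarch_local_field"
  using powi_le_powi_iff[OF card_residue_field_gt_1[where 'a='a], of "- val x" "-1"]
  by (auto simp: maximal_ideal_def absval_def power_int_minus)

text \<open>Together with \<open>maximal_ideal_iff\<close> this expresses that the valuation is
  discrete: no absolute value lies strictly between 1/q and 1. The maximal ideal is therefore both
  an open and a closed ball.\<close>

lemma maximal_ideal_iff_less: "x \<in> maximal_ideal \<longleftrightarrow> absval x < 1"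
  for x :: "'a::nonarch_local_field"
  using powi_le_powi_iff[OF card_residue_field_gt_1[where 'a='a], of 0 "- val x"]
  by (auto simp: maximal_ideal_def absval_def)

lemma obtain_uniformizer:
  obtains p :: "'a::nonarch_local_field"
  where "p \<noteq> 0" "absval p = inverse (real (card (residue_field :: 'a set set)))"
  using ex_uniformizer[where 'a='a] by (auto simp: absval_def power_int_minus)

lemma obtain_small_uniformizer:
  obtains p :: "'a::nonarch_local_field" where "0 < absval p" "absval p < 1"
  using obtain_uniformizer[where 'a='a] card_residue_field_gt_1[where 'a='a]
  by (metis absval_pos inverse_less_1_iff less_numeral_extra(1) order_less_trans)


section \<open>Topology\<close>

lemma tendsto_iff_absval:
  "(f \<longlongrightarrow> l) F \<longleftrightarrow> (\<forall>e>0. eventually (\<lambda>x. absval (f x - l) < e) F)"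
  for l :: "'a::nonarch_local_field"
  by (simp add: tendsto_iff dist_absval)

section \<open>Continuity of the field operations\<close>

instance nonarch_local_field \<subseteq> topological_comm_monoid_add
proof
  fix a b :: 'a
  show "((\<lambda>x. fst x + snd x) \<longlongrightarrow> a + b) (nhds a \<times>\<^sub>F nhds b)"
    unfolding tendsto_iff_absval
  proof (intro allI impI)
    fix e :: real assume "e > 0"
    then have "eventually (\<lambda>x. absval (x - c) < e) (nhds c)" for c :: 'a
      by (auto simp: eventually_nhds_metric dist_absval)
    then have "eventually (\<lambda>x. absval (fst x - a) < e \<and> absval (snd x - b) < e) (nhds a \<times>\<^sub>F nhds b)"
      by (intro eventually_prodI) auto
    then show "eventually (\<lambda>x. absval (fst x + snd x - (a + b)) < e) (nhds a \<times>\<^sub>F nhds b)"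
      by (rule eventually_mono)
        (metis absval_add_max add_diff_add max_less_iff_conj order_le_less_trans)
  qed
qed

instance nonarch_local_field \<subseteq> topological_ab_group_add
proof
  fix a :: 'a
  show "(uminus \<longlongrightarrow> - a) (nhds a)"
    unfolding tendsto_iff_absval minus_diff_minus absval_minus
    by (auto simp: eventually_nhds_metric dist_absval)
qed

instance nonarch_local_field \<subseteq> topological_semigroup_mult
proof
  fix a b :: 'a
  show "((\<lambda>x. fst x * snd x) \<longlongrightarrow> a * b) (nhds a \<times>\<^sub>F nhds b)"
    unfolding tendsto_iff_absval
  proof (intro allI impI)
    fix e :: real assume e: "e > 0"
    \<comment> \<open>The error is \<open>(x - a) * y + a * (y - b)\<close> with |y| \<le> 1 + |b|,
      where d \<le> 1 is used; it is thus smaller than d (1 + |a| + |b|).\<close>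
    define d where "d = min 1 (e / (1 + absval a + absval b))"
    have pos: "0 < 1 + absval a + absval b"
      using absval_nonneg[of a] absval_nonneg[of b] by linarith
    with e have d: "d > 0" "d \<le> 1"
      by (auto simp: d_def)
    have "d \<le> e / (1 + absval a + absval b)"
      by (simp add: d_def)
    with pos have d3: "d * (1 + absval a + absval b) \<le> e"
      by (simp add: pos_le_divide_eq)
    have "eventually (\<lambda>x. absval (x - c) < d) (nhds c)" for c :: 'a
      using d by (auto simp: eventually_nhds_metric dist_absval)
    then have "eventually (\<lambda>x. absval (fst x - a) < d \<and> absval (snd x - b) < d) (nhds a \<times>\<^sub>F nhds b)"
      by (intro eventually_prodI) auto
    then show "eventually (\<lambda>x. absval (fst x * snd x - a * b) < e) (nhds a \<times>\<^sub>F nhds b)"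
    proof (rule eventually_mono)
      fix x assume x: "absval (fst x - a) < d \<and> absval (snd x - b) < d"
      have "absval (snd x) \<le> 1 + absval b"
        using absval_triangle[of "snd x - b" b] x d by simp
      then have "absval (fst x - a) * absval (snd x) \<le> absval (fst x - a) * (1 + absval b)"
        by (intro mult_left_mono) auto
      also have "\<dots> < d * (1 + absval b)"
        using x absval_nonneg[of b] by (intro mult_strict_right_mono) linarith+
      moreover have "absval a * absval (snd x - b) \<le> absval a * d"
        using x by (intro mult_left_mono) auto
      moreover have "fst x * snd x - a * b = (fst x - a) * snd x + a * (snd x - b)"
        by (simp add: algebra_simps)
      ultimately have "absval (fst x * snd x - a * b) < d * (1 + absval b) + absval a * d"
        using absval_triangle[of "(fst x - a) * snd x" "a * (snd x - b)"] by (simp add: absval_mult)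
      with d3 show "absval (fst x * snd x - a * b) < e"
        by (simp add: algebra_simps)
    qed
  qed
qed

text \<open>The ring of integers is totally bounded: expansions in powers of \<open>p\<close>,
  truncated after \<open>n\<close> digits taken from representatives of the finitely many residue
  classes, form a finite net.\<close>

lemma finite_net:
  "\<exists>D :: 'a set. finite D \<and> (\<forall>x. absval x \<le> 1 \<longrightarrow> (\<exists>d\<in>D. absval (x - d) \<le> absval p ^ n))"
  if p: "p \<noteq> 0" "absval p = inverse (real (card (residue_field :: 'a set set)))"
  for p :: "'a::nonarch_local_field"
proof (induction n)
  case 0
  show ?case by (intro exI[of _ "{0}"]) simp
next
  case (Suc n)
  then obtain D :: "'a set" where D: "finite D" "\<forall>x. absval x \<le> 1 \<longrightarrow> (\<exists>d\<in>D. absval (x - d) \<le> absval p ^ n)"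
    by blast
  define r where "r C = (SOME x. x \<in> C)" for C :: "'a set"
  have r: "\<exists>C\<in>residue_field. absval (x - r C) \<le> absval p" if "absval x \<le> 1" for x
  proof -
    let ?C = "(+) x ` (maximal_ideal :: 'a set)"
    have "(0 :: 'a) \<in> maximal_ideal" by (simp add: maximal_ideal_def)
    then have "x + 0 \<in> ?C" by (rule imageI)
    then have "r ?C \<in> ?C"
      unfolding r_def by (rule someI)
    then obtain m where "m \<in> maximal_ideal" "r ?C = x + m" by blast
    then have "absval (x - r ?C) \<le> absval p"
      using p by (simp add: maximal_ideal_iff)
    moreover have "?C \<in> residue_field"
      using that by (auto simp: residue_field_eq ring_of_integers_iff)
    ultimately show ?thesis by blast
  qed
  show ?case
  proof (intro exI[of _ "(\<lambda>(C, d). r C + p * d) ` (residue_field \<times> D)"] conjI allI impI)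
    show "finite ((\<lambda>(C, d). r C + p * d) ` (residue_field \<times> D))"
      using D finite_residue_field by auto
  next
    fix x :: 'a assume "absval x \<le> 1"
    then obtain C where C: "C \<in> residue_field" "absval (x - r C) \<le> absval p"
      using r[of x] by auto
    then have "absval ((x - r C) / p) \<le> 1"
      using p by (simp add: absval_divide divide_le_eq)
    with D obtain d where d: "d \<in> D" "absval ((x - r C) / p - d) \<le> absval p ^ n"
      by blast
    have "x - (r C + p * d) = p * ((x - r C) / p - d)"
      using p by (simp add: field_simps)
    then have "absval (x - (r C + p * d)) \<le> absval p ^ Suc n"
      using d p by (simp add: absval_mult mult_left_mono del: absval_pos)
    with C d show "\<exists>d\<in>(\<lambda>(C, d). r C + p * d) ` (residue_field \<times> D). absval (x - d) \<le> absval p ^ Suc n"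
      by force
  qed
qed

text \<open>A power of \<open>p\<close> moves any given element into the ring of integers, where the
  finite nets are available; dividing them back by all powers of \<open>p\<close> yields a countable
  dense set.\<close>

lemma countable_dense:
  "\<exists>D :: 'a::nonarch_local_field set. countable D \<and> (\<forall>x. \<forall>e>0. \<exists>d\<in>D. dist x d < e)"
proof -
  obtain p :: 'a where p: "p \<noteq> 0" "absval p = inverse (real (card (residue_field :: 'a set set)))"
    using obtain_uniformizer .
  then have p1: "absval p < 1"
    using card_residue_field_gt_1[where 'a='a] by (simp add: inverse_less_1_iff)
  define N where "N n = (SOME D :: 'a set. finite D \<and> (\<forall>x. absval x \<le> 1 \<longrightarrow> (\<exists>d\<in>D. absval (x - d) \<le> absval p ^ n)))" for n :: nat
  have N: "finite (N n)" "absval x \<le> 1 \<Longrightarrow> \<exists>d\<in>N n. absval (x - d) \<le> absval p ^ n" for n x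
    using someI_ex[OF finite_net[OF p, of n]] by (auto simp: N_def)
  show ?thesis
  proof (intro exI conjI allI impI)
    show "countable (\<Union>n k. (\<lambda>d. d / p ^ k) ` N n)"
      using N by (intro countable_UN countable_image) (auto intro: countable_finite)
  next
    fix x :: 'a and e :: real assume e: "e > 0"
    obtain k where k: "absval p ^ k < inverse (1 + absval x)"
      using real_arch_pow_inv[of "inverse (1 + absval x)" "absval p"] p1 by (auto simp: add_pos_nonneg)
    have pk: "absval p ^ k > 0" using p by (metis absval_pos zero_less_power)
    have "absval (x * p ^ k) \<le> absval x * inverse (1 + absval x)"
      using k by (simp add: absval_mult absval_power mult_left_mono)
    also have "\<dots> \<le> 1"
      by (simp add: field_simps add_pos_nonneg)
    finally have xk: "absval (x * p ^ k) \<le> 1" .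
    obtain n where n: "absval p ^ n < e * absval p ^ k"
      using real_arch_pow_inv[of "e * absval p ^ k" "absval p"] p1 pk e by auto
    obtain d where d: "d \<in> N n" "absval (x * p ^ k - d) \<le> absval p ^ n"
      using N(2)[OF xk] by blast
    have "x - d / p ^ k = (x * p ^ k - d) / p ^ k"
      using p by (simp add: field_simps)
    then have "absval (x - d / p ^ k) < e"
      using d n pk by (simp add: absval_divide absval_power divide_less_eq)
    with d show "\<exists>d\<in>\<Union>n k. (\<lambda>d. d / p ^ k) ` N n. dist x d < e"
      by (auto simp: dist_absval)
  qed
qed

text \<open>Second countability makes the Borel sets of a finite product agree with the product
  sigma-algebra, which is what gives access to \<open>coordinate_measure\<close>.\<close>

instance nonarch_local_field \<subseteq> second_countable_topology
proof
  obtain D :: "'a set" where D: "countable D" "\<And>x e. e > 0 \<Longrightarrow> \<exists>d\<in>D. dist x d < e"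
    using countable_dense[where 'a='a] by blast
  define B where "B = (\<lambda>(d, n). ball d (inverse (real (Suc n)))) ` (D \<times> UNIV)"
  have "topological_basis B"
  proof (rule topological_basisI)
    fix U :: "'a set" and x assume U: "open U" "x \<in> U"
    then obtain e where e: "e > 0" "ball x e \<subseteq> U"
      by (meson openE)
    obtain n where n: "inverse (real (Suc n)) < e / 2"
      using reals_Archimedean[of "e / 2"] e by auto
    obtain d where d: "d \<in> D" "dist x d < inverse (real (Suc n))"
      using D(2)[of "inverse (real (Suc n))" x] by auto
    have "ball d (inverse (real (Suc n))) \<subseteq> ball x e"
    proof
      fix z assume "z \<in> ball d (inverse (real (Suc n)))"
      then show "z \<in> ball x e"
        using d n dist_triangle[of x z d] by (simp add: dist_commute)
    qed
    with d e show "\<exists>B'\<in>B. x \<in> B' \<and> B' \<subseteq> U"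
      by (intro bexI[of _ "ball d (inverse (real (Suc n)))"]) (auto simp: B_def dist_commute)
  qed (auto simp: B_def)
  moreover have "countable B"
    using D by (auto simp: B_def)
  ultimately show "\<exists>B::'a set set. countable B \<and> open = generate_topology B"
    by (auto simp: topological_basis_imp_subbasis)
qed


section \<open>Haar measure\<close>

lemma open_maximal_ideal: "open (maximal_ideal :: 'a::nonarch_local_field set)"
proof -
  have *: "(maximal_ideal :: 'a set) = ball 0 1"
    by (auto simp: maximal_ideal_iff_less dist_absval)
  show ?thesis unfolding * by (rule open_ball)
qed

lemma closed_ring_of_integers: "closed (ring_of_integers :: 'a::nonarch_local_field set)"
proof -
  have *: "(ring_of_integers :: 'a set) = cball 0 1"
    by (auto simp: ring_of_integers_iff dist_absval)
  show ?thesis unfolding * by (rule closed_cball)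
qed

lemma image_add_eq_vimage: "(+) a ` A = (+) (- a) -` A" for a :: "'a::group_add"
  by (force simp: image_iff)

lemma translate_borel:
  fixes a :: "'a::nonarch_local_field"
  assumes "A \<in> sets borel"
  shows "(+) a ` A \<in> sets borel"
proof -
  have "(+) (- a) \<in> borel_measurable borel"
    by (intro borel_measurable_continuous_onI continuous_intros)
  with assms show ?thesis
    unfolding image_add_eq_vimage using measurable_sets_borel by blast
qed

context
  fixes \<mu> :: "'a::nonarch_local_field measure"
  assumes haar: "normalized_haar_measure \<mu>"
begin

lemma sets_haar [simp, measurable_cong]: "sets \<mu> = sets borel"
  using haar by (simp add: normalized_haar_measure_def)

lemma space_haar [simp]: "space \<mu> = UNIV"
  using sets_eq_imp_space_eq[OF sets_haar] by simp

lemma emeasure_translate: "A \<in> sets borel \<Longrightarrow> emeasure \<mu> ((+) a ` A) = emeasure \<mu> A"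
  using haar by (simp add: normalized_haar_measure_def)

lemma emeasure_ring_of_integers: "emeasure \<mu> ring_of_integers = 1"
  using haar by (simp add: normalized_haar_measure_def)

text \<open>Translates of the ring of integers by a countable dense set cover the field and have
  measure one. Sigma-finiteness is what product measures require.\<close>

lemma sigma_finite_haar: "sigma_finite_measure \<mu>"
proof
  obtain D :: "'a set" where D: "countable D" "\<And>x e. e > 0 \<Longrightarrow> \<exists>d\<in>D. dist x d < e"
    using countable_dense[where 'a='a] by blast
  have "x \<in> (\<Union>d\<in>D. (+) d ` ring_of_integers)" for x
  proof -
    obtain d where "d \<in> D" "dist x d < 1" using D(2)[of 1 x] by auto
    then have "x - d \<in> ring_of_integers" "x = d + (x - d)"
      by (auto simp: ring_of_integers_iff dist_absval)
    with \<open>d \<in> D\<close> show ?thesis by blast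
  qed
  then show "\<exists>A. countable A \<and> A \<subseteq> sets \<mu> \<and> \<Union> A = space \<mu> \<and> (\<forall>a\<in>A. emeasure \<mu> a \<noteq> \<infinity>)"
    using D(1) borel_closed[OF closed_ring_of_integers]
    by (intro exI[of _ "(\<lambda>d. (+) d ` ring_of_integers) ` D"])
      (auto simp: emeasure_translate emeasure_ring_of_integers intro!: translate_borel)
qed

text \<open>The ring of integers, of measure one, is the disjoint union of q translates of the
  maximal ideal. This is the origin of the summand 1/q in the result.\<close>

lemma emeasure_maximal_ideal:
  "emeasure \<mu> maximal_ideal = ennreal (inverse (real (card (residue_field :: 'a set set))))"
proof -
  let ?q = "card (residue_field :: 'a set set)"
  have cls: "emeasure \<mu> C = emeasure \<mu> maximal_ideal" "C \<in> sets \<mu>" if "C \<in> residue_field" for C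
    using that emeasure_translate[OF borel_open[OF open_maximal_ideal]]
      translate_borel[OF borel_open[OF open_maximal_ideal]]
    by (auto simp: residue_field_eq)
  have "equiv ring_of_integers {(x, y). x \<in> ring_of_integers \<and> y \<in> ring_of_integers \<and> x - y \<in> (maximal_ideal :: 'a set)}"
  proof (intro equivI)
    show "refl_on ring_of_integers {(x, y). x \<in> ring_of_integers \<and> y \<in> ring_of_integers \<and> x - y \<in> (maximal_ideal :: 'a set)}"
      by (auto simp: refl_on_def maximal_ideal_def)
    show "sym {(x, y). x \<in> ring_of_integers \<and> y \<in> ring_of_integers \<and> x - y \<in> (maximal_ideal :: 'a set)}"
      by (auto simp: sym_def maximal_ideal_iff absval_minus_commute)
    show "trans {(x, y). x \<in> ring_of_integers \<and> y \<in> ring_of_integers \<and> x - y \<in> (maximal_ideal :: 'a set)}"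
    proof (rule transI, clarsimp)
      fix x y z :: 'a assume "x - y \<in> maximal_ideal" "y - z \<in> maximal_ideal"
      then show "x - z \<in> maximal_ideal"
        using absval_add_le[of "x - y" _ "y - z"] by (simp add: maximal_ideal_iff)
    qed
  qed auto
  then have "disjoint (residue_field :: 'a set set)" "\<Union> residue_field = (ring_of_integers :: 'a set)"
    unfolding residue_field_def
    by (auto simp: disjoint_def dest: quotient_disj Union_quotient)
  then have "emeasure \<mu> ring_of_integers = (\<Sum>C\<in>residue_field. emeasure \<mu> C)"
    using cls finite_residue_field[where 'a='a]
    by (subst sum_emeasure) (auto simp: disjoint_family_on_disjoint_image disjoint_family_on_def disjoint_def)
  also have "\<dots> = of_nat ?q * emeasure \<mu> maximal_ideal"
    using cls by simp
  finally have 1: "of_nat ?q * emeasure \<mu> maximal_ideal = 1"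
    by (simp add: emeasure_ring_of_integers)
  have "ennreal (real ?q) * ennreal (inverse (real ?q)) = 1"
    using card_residue_field_gt_1[where 'a='a] by (subst ennreal_mult[symmetric]) auto
  then show ?thesis
    using 1 by (metis ennreal_of_nat_eq_real_of_nat mult.assoc mult.commute mult.right_neutral)
qed

text \<open>The integral points and the parameter domains of the charts are boxes, so this formula
  is all the integration in several variables that is needed.\<close>

lemma emeasure_coordinate_box:
  fixes B :: "'k::finite \<Rightarrow> 'a set"
  assumes B: "\<And>i. B i \<in> sets borel"
  shows "{t. \<forall>i. t $ i \<in> B i} \<in> sets borel"
    and "emeasure (coordinate_measure \<mu>) {t. \<forall>i. t $ i \<in> B i} = (\<Prod>i\<in>UNIV. emeasure \<mu> (B i))"
proof -
  interpret product_sigma_finite "\<lambda>i::'k. \<mu>"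
    by (simp add: product_sigma_finite_def sigma_finite_haar)
  have comp: "(\<lambda>t :: 'a ^ 'k. t $ i) \<in> borel_measurable borel" for i
    by (intro borel_measurable_continuous_onI continuous_on_component continuous_on_id)
  have "{t. \<forall>i. t $ i \<in> B i} = (\<Inter>i. (\<lambda>t. t $ i) -` B i)"
    by auto
  also have "\<dots> \<in> sets borel"
    using measurable_sets_borel[OF comp B] by (intro sets.finite_INT) auto
  finally show box: "{t. \<forall>i. t $ i \<in> B i} \<in> sets borel" .
  have "continuous_on UNIV (vec_lambda :: ('k \<Rightarrow> 'a) \<Rightarrow> 'a ^ 'k)"
    using continuous_on_vec_lambda[of UNIV "\<lambda>i x. x i"] continuous_on_product_coordinates by simp
  then have "vec_lambda \<in> borel_measurable (borel :: ('k \<Rightarrow> 'a) measure)"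
    by (rule borel_measurable_continuous_onI)
  also have "borel_measurable (borel :: ('k \<Rightarrow> 'a) measure) = borel_measurable (\<Pi>\<^sub>M i\<in>(UNIV::'k set). \<mu>)"
    by (intro measurable_cong_sets) (simp_all flip: sets_PiM_equal_borel cong: sets_PiM_cong)
  finally have "emeasure (coordinate_measure \<mu>) {t. \<forall>i. t $ i \<in> B i} =
     emeasure (\<Pi>\<^sub>M i\<in>(UNIV::'k set). \<mu>) (vec_lambda -` {t. \<forall>i. t $ i \<in> B i} \<inter> space (\<Pi>\<^sub>M i\<in>(UNIV::'k set). \<mu>))"
    unfolding coordinate_measure_def using box by (rule emeasure_distr)
  also have "vec_lambda -` {t. \<forall>i. t $ i \<in> B i} \<inter> space (\<Pi>\<^sub>M i\<in>(UNIV::'k set). \<mu>) = (\<Pi>\<^sub>E i\<in>UNIV. B i)"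
    by (auto simp: space_PiM)
  also have "emeasure (\<Pi>\<^sub>M i\<in>(UNIV::'k set). \<mu>) \<dots> = (\<Prod>i\<in>UNIV. emeasure \<mu> (B i))"
    using B by (intro emeasure_PiM) auto
  finally show "emeasure (coordinate_measure \<mu>) {t. \<forall>i. t $ i \<in> B i} = (\<Prod>i\<in>UNIV. emeasure \<mu> (B i))" .
qed

end

section \<open>Jacobians and analytic maps\<close>

text \<open>The metric on vectors is the Euclidean combination of the coordinate distances and is
  not ultrametric in general. This bound and the next ones mediate between it and the coordinates,
  where the ultrametric inequality holds.\<close>

lemma absval_le_dist: "absval (x $ i - y $ i) \<le> dist x y"
  for x y :: "'a::nonarch_local_field ^ 'm::finite"
  using dist_vec_nth_le[of x i y] by (simp add: dist_absval)

lemma dist_le_sum_absval: "dist x y \<le> (\<Sum>i\<in>UNIV. absval (x $ i - y $ i))"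
  for x y :: "'a::nonarch_local_field ^ 'm::finite"
  unfolding dist_vec_def using L2_set_le_sum[of UNIV "\<lambda>i. dist (x $ i) (y $ i)"]
  by (simp add: dist_absval)

lemma dist_le_card_mult:
  fixes x y :: "'a::nonarch_local_field ^ 'm::finite"
  assumes "\<And>i. absval (x $ i - y $ i) \<le> c"
  shows "dist x y \<le> real CARD('m) * c"
  using dist_le_sum_absval[of x y] sum_bounded_above[of UNIV "\<lambda>i. absval (x $ i - y $ i)" c] assms
  by fastforce

lemma dist_add_axis: "dist (x + axis j a) x = absval a"
  for x :: "'a::nonarch_local_field ^ 'm::finite"
proof (rule antisym)
  have "(\<Sum>i\<in>UNIV. absval ((x + axis j a) $ i - x $ i)) = (\<Sum>i\<in>UNIV. if i = j then absval a else 0)"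
    by (intro sum.cong) (auto simp: axis_def)
  then show "dist (x + axis j a) x \<le> absval a"
    using dist_le_sum_absval[of "x + axis j a" x] by simp
  show "absval a \<le> dist (x + axis j a) x"
    using absval_le_dist[of "x + axis j a" j x] by (simp add: axis_def)
qed

lemma matrix_vector_mult_axis: "(D *v axis j a) $ i = D $ i $ j * a"
  for D :: "'a::comm_ring_1 ^ 'k::finite ^ 'm"
proof -
  have "(\<Sum>k\<in>UNIV. D $ i $ k * axis j a $ k) = (\<Sum>k\<in>UNIV. if k = j then D $ i $ j * a else 0)"
    by (intro sum.cong) (auto simp: axis_def)
  then show ?thesis by (simp add: matrix_vector_mult_def)
qed

text \<open>A quadratic remainder makes the quotient in \<open>has_jacobian\<close> at most a
  constant times the distance. Testing only increments with integral coordinates lets cubic terms of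
  a polynomial map be absorbed into the quadratic bound.\<close>

lemma has_jacobian_quadratic:
  fixes f :: "'a::nonarch_local_field ^ 'k::finite \<Rightarrow> 'a ^ 'm::finite"
  assumes remainder: "\<And>h i. (\<And>j. absval (h $ j) \<le> 1) \<Longrightarrow>
    absval (f (x + h) $ i - f x $ i - (D *v h) $ i) \<le> C * (dist (x + h) x)\<^sup>2"
  shows "has_jacobian f D x"
  unfolding has_jacobian_def tendsto_iff eventually_at
proof (intro allI impI)
  fix e :: real assume e: "e > 0"
  \<comment> \<open>The factor \<open>CARD('m)\<close> pays for passing from coordinates to the
    metric; the summand 1 keeps \<open>K\<close> positive even for \<open>C = 0\<close>.\<close>
  define K where "K = real CARD('m) * \<bar>C\<bar> + 1"
  have K: "K > 0" by (simp add: K_def add_nonneg_pos)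
  show "\<exists>d>0. \<forall>y\<in>UNIV. y \<noteq> x \<and> dist y x < d \<longrightarrow>
      dist (dist (f y) (f x + D *v (y - x)) / dist y x) 0 < e"
  proof (intro exI[of _ "min 1 (e / K)"] conjI ballI impI)
    fix y assume y: "y \<noteq> x \<and> dist y x < min 1 (e / K)"
    then have pos: "dist y x > 0" by simp
    have 1: "absval ((y - x) $ j) \<le> 1" for j
      using absval_le_dist[of y j x] y by simp
    have "absval (f y $ i - (f x + D *v (y - x)) $ i) \<le> C * (dist y x)\<^sup>2" for i
      using remainder[of "y - x" i, OF 1] by (simp add: diff_diff_eq)
    then have "dist (f y) (f x + D *v (y - x)) \<le> real CARD('m) * (C * (dist y x)\<^sup>2)"
      by (rule dist_le_card_mult)
    also have "\<dots> \<le> real CARD('m) * (\<bar>C\<bar> * (dist y x)\<^sup>2)"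
      by (intro mult_left_mono mult_right_mono) auto
    also have "\<dots> = (real CARD('m) * \<bar>C\<bar>) * dist y x * dist y x"
      by (simp add: power2_eq_square)
    also have "\<dots> \<le> K * dist y x * dist y x"
      by (intro mult_right_mono) (auto simp: K_def)
    finally have "dist (f y) (f x + D *v (y - x)) / dist y x \<le> K * dist y x"
      using pos by (simp add: divide_le_eq)
    also have "\<dots> < e"
      using y K by (simp add: pos_less_divide_eq mult.commute)
    finally show "dist (dist (f y) (f x + D *v (y - x)) / dist y x) 0 < e"
      by simp
  qed (use e K in auto)
qed

text \<open>If two candidates differ in the entry (i, j), approach \<open>x\<close> along the j-th
  axis by powers of an element of absolute value below one: the two linear approximations then stay
  apart by a fixed multiple of the distance. Uniqueness gives meaning to the definite description in
  \<open>jacobian\<close>.\<close>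

lemma has_jacobian_unique:
  fixes f :: "'a::nonarch_local_field ^ 'k::finite \<Rightarrow> 'a ^ 'm::finite"
  assumes "has_jacobian f D x" "has_jacobian f D' x"
  shows "D = D'"
proof (rule ccontr)
  assume "D \<noteq> D'"
  then obtain i j where ij: "D $ i $ j \<noteq> D' $ i $ j"
    by (auto simp: vec_eq_iff)
  define c where "c = absval (D $ i $ j - D' $ i $ j)"
  have c: "c > 0" using ij by (simp add: c_def)
  have "eventually (\<lambda>y. dist (f y) (f x + E *v (y - x)) / dist y x < c / 2) (at x)"
    if "has_jacobian f E x" for E
    using that c unfolding has_jacobian_def by (intro order_tendstoD(2)[where y = 0]) auto
  from eventually_conj[OF this[OF assms(1)] this[OF assms(2)]]
  obtain d where d: "d > 0" and close: "\<And>y. y \<noteq> x \<Longrightarrow> dist y x < d \<Longrightarrow>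
      dist (f y) (f x + D *v (y - x)) / dist y x < c / 2 \<and>
      dist (f y) (f x + D' *v (y - x)) / dist y x < c / 2"
    unfolding eventually_at by auto
  obtain p :: 'a where p: "0 < absval p" "absval p < 1"
    using obtain_small_uniformizer .
  obtain n where n: "absval p ^ n < d"
    using real_arch_pow_inv[OF d p(2)] by blast
  define a where "a = p ^ n"
  have a: "0 < absval a" "absval a < d"
    using p n by (simp_all add: a_def absval_power del: absval_pos)
  define y where "y = x + axis j a"
  have dy: "dist y x = absval a" by (simp add: y_def dist_add_axis)
  then have "y \<noteq> x" using a by auto
  then   have "dist (f x + D *v (y - x)) (f x + D' *v (y - x)) < c * absval a"
    using close[of y] a dy dist_triangle3[of "f x + D *v (y - x)" "f x + D' *v (y - x)" "f y"]
    by (auto simp: divide_less_eq)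
  moreover have "absval ((f x + D *v (y - x)) $ i - (f x + D' *v (y - x)) $ i) = c * absval a"
    by (simp add: y_def matrix_vector_mult_axis c_def flip: absval_mult) (simp add: algebra_simps)
  ultimately show False
    using absval_le_dist[of "f x + D *v (y - x)" i "f x + D' *v (y - x)"] by simp
qed

lemma jacobian_eq: "has_jacobian f D x \<Longrightarrow> jacobian f x = D"
  unfolding jacobian_def by (blast intro: has_jacobian_unique)

text \<open>A polynomial is a power series with finitely many nonzero coefficients. The list of
  monomials may repeat an exponent, so coefficients belonging to equal exponents are added
  up.\<close>

lemma analytic_at_polynomial:
  fixes f :: "'a::nonarch_local_field ^ 'k::finite \<Rightarrow> 'a ^ 'm::finite"
  assumes "\<And>i. \<exists>L. \<forall>t. f t $ i = (\<Sum>(a, \<alpha>)\<leftarrow>L. a * (\<Prod>j\<in>UNIV. (t $ j - s $ j) ^ \<alpha> j))"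
  shows "analytic_at f s"
  unfolding analytic_at_def
proof
  fix i
  obtain L where L: "\<And>t. f t $ i = (\<Sum>(a, \<alpha>)\<leftarrow>L. a * (\<Prod>j\<in>UNIV. (t $ j - s $ j) ^ \<alpha> j))"
    using assms by blast
  define c where "c \<alpha> = (\<Sum>(a, \<beta>)\<leftarrow>L. if \<beta> = \<alpha> then a else 0)" for \<alpha>
  have collect: "(\<Sum>(a, \<alpha>)\<leftarrow>M. a * m \<alpha>) = (\<Sum>\<alpha>\<in>S. (\<Sum>(a, \<beta>)\<leftarrow>M. if \<beta> = \<alpha> then a else 0) * m \<alpha>)"
    if "finite S" "snd ` set M \<subseteq> S" for M S and m :: "('k \<Rightarrow> nat) \<Rightarrow> 'a"
    using that(2)
  proof (induction M)
    case (Cons b M)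
    have "(\<Sum>\<alpha>\<in>S. (if snd b = \<alpha> then fst b else 0) * m \<alpha>) = (\<Sum>\<alpha>\<in>S. if snd b = \<alpha> then fst b * m \<alpha> else 0)"
      by (intro sum.cong) auto
    also have "\<dots> = fst b * m (snd b)"
      using Cons.prems that(1) by simp
    finally show ?case
      using Cons by (simp add: case_prod_beta distrib_right sum.distrib)
  qed simp
  have zero: "c \<alpha> = 0" if "\<alpha> \<notin> snd ` set L" for \<alpha>
    using that unfolding c_def by (induction L) auto
  have "((\<lambda>\<alpha>. c \<alpha> * (\<Prod>j\<in>UNIV. (t $ j - s $ j) ^ \<alpha> j)) has_sum f t $ i) UNIV" for t
  proof -
    let ?g = "\<lambda>\<alpha>. c \<alpha> * (\<Prod>j\<in>UNIV. (t $ j - s $ j) ^ \<alpha> j)"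
    have "(?g has_sum f t $ i) (snd ` set L)"
      unfolding L c_def by (rule has_sum_finiteI[OF _ collect]) auto
    then show ?thesis
      by (rule has_sum_cong_neutral[THEN iffD1, rotated -1]) (auto simp: zero)
  qed
  then have "\<forall>\<^sub>F t in nhds s. ((\<lambda>\<alpha>. c \<alpha> * (\<Prod>j\<in>UNIV. (t $ j - s $ j) ^ \<alpha> j)) has_sum f t $ i) UNIV"
    by (intro always_eventually allI)
  then show "\<exists>c. \<forall>\<^sub>F t in nhds s. ((\<lambda>\<alpha>. c \<alpha> * (\<Prod>j\<in>UNIV. (t $ j - s $ j) ^ \<alpha> j)) has_sum f t $ i) UNIV"
    by (intro exI[of _ c])
qed


section \<open>Alternating forms\<close>

lemma alternating_form_add: "alternating_form \<omega> \<Longrightarrow> \<omega> (v(i := x + y)) = \<omega> (v(i := x)) + \<omega> (v(i := y))"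
  and alternating_form_scale: "alternating_form \<omega> \<Longrightarrow> \<omega> (v(i := a *s x)) = a * \<omega> (v(i := x))"
  and alternating_form_eq: "alternating_form \<omega> \<Longrightarrow> i \<noteq> j \<Longrightarrow> v i = v j \<Longrightarrow> \<omega> v = 0"
  by (auto simp: alternating_form_def)

lemma alternating_form_sum:
  fixes \<omega> :: "('k::finite \<Rightarrow> 'a::field ^ 'm::finite) \<Rightarrow> 'a"
  assumes "alternating_form \<omega>" "finite S"
  shows "\<omega> (v(i := \<Sum>j\<in>S. c j *s x j)) = (\<Sum>j\<in>S. c j * \<omega> (v(i := x j)))"
  using assms(2)
proof induction
  case empty
  show ?case using alternating_form_scale[OF assms(1), of v i 0 0]
    by (simp add: fun_upd_def)
next
  case (insert k S)
  show ?case
    unfolding sum.insert[OF insert.hyps] alternating_form_add[OF assms(1)]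
      alternating_form_scale[OF assms(1)] insert.IH ..
qed

lemma alternating_form_swap:
  fixes \<omega> :: "('k::finite \<Rightarrow> 'a::field ^ 'm::finite) \<Rightarrow> 'a"
  assumes alt: "alternating_form \<omega>" and ij: "i \<noteq> j"
  shows "\<omega> (v \<circ> Transposition.transpose i j) = - \<omega> v"
proof -
  let ?w = "\<lambda>x y. v(i := x, j := y)"
  have j: "\<omega> (?w x (y + z)) = \<omega> (?w x y) + \<omega> (?w x z)" for x y z
    by (rule alternating_form_add[OF alt])
  have i: "\<omega> (?w (x + y) z) = \<omega> (?w x z) + \<omega> (?w y z)" for x y z
    using alternating_form_add[OF alt, of "v(j := z)" i x y] ij by (simp add: fun_upd_twist)
  have z: "\<omega> (?w x x) = 0" for x
    using ij by (intro alternating_form_eq[OF alt, of i j]) auto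
  have "\<omega> (?w (v i) (v j)) + \<omega> (?w (v j) (v i)) = 0"
    using z[of "v i + v j"] unfolding i j z[of "v i"] z[of "v j"]
    by (simp only: add_0_left add_0_right add.commute)
  moreover have "v \<circ> Transposition.transpose i j = ?w (v j) (v i)"
    using ij by (auto simp: fun_eq_iff Transposition.transpose_def)
  ultimately show ?thesis
    by (simp add: add_eq_0_iff)
qed

text \<open>Multilinearity reduces the claim to tuples of axis vectors; a repeated axis gives 0, and
  any other tuple arises from the basis by transpositions, which only change the sign. Arguments and
  coordinates are indexed by different types, whence the bijection \<open>\<sigma>\<close>.\<close>

lemma alternating_form_eq_0:
  fixes \<omega> :: "('k::finite \<Rightarrow> 'a::field ^ 'm::finite) \<Rightarrow> 'a"
  assumes alt: "alternating_form \<omega>" and \<sigma>: "bij \<sigma>"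
    and basis: "\<omega> (\<lambda>k. axis (\<sigma> k) 1) = 0"
  shows "\<omega> v = 0"
proof -
  have axes: "\<omega> (\<lambda>k. axis (f k) 1) = 0" for f
  proof (cases "inj f")
    case False
    then obtain i j where "i \<noteq> j" "f i = f j" by (auto simp: inj_def)
    then show ?thesis by (intro alternating_form_eq[OF alt, of i j]) auto
  next
    case True
    define p where "p = inv \<sigma> \<circ> f"
    have "inj p"
      unfolding p_def using True \<sigma> by (simp add: inj_compose bij_imp_bij_inv bij_is_inj)
    then have "p permutes UNIV"
      by (intro bij_imp_permutes) (auto simp: bij_def finite_UNIV_inj_surj)
    with finite have "\<omega> (\<lambda>k. axis (\<sigma> (p k)) 1) = 0"
    proof (induction rule: permutes_rev_induct)
      case (swap a b p)
      then show ?case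
        using alternating_form_swap[OF alt, of a b "\<lambda>k. axis (\<sigma> (p k)) 1"]
        by (cases "a = b") (auto simp: o_def)
    qed (use basis in auto)
    then show ?thesis
      using \<sigma> by (simp add: p_def bij_is_surj surj_f_inv_f)
  qed
  \<comment> \<open>\<open>S\<close> contains the arguments not yet known to be axis vectors; each
    step of the induction expands one of them in the standard basis.\<close>
  have "\<omega> v = 0" if "\<forall>k. k \<notin> S \<longrightarrow> (\<exists>m. v k = axis m 1)" for S v
    using finite[of S] that
  proof (induction S arbitrary: v rule: finite_induct)
    case empty
    then have "\<forall>k. \<exists>m. v k = axis m 1" by simp
    then have "\<exists>f. \<forall>k. v k = axis (f k) 1" by (rule choice)
    then obtain f where "\<forall>k. v k = axis (f k) 1" by blast
    then have "v = (\<lambda>k. axis (f k) 1)" by auto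
    then show ?case using axes by simp
  next
    case (insert i S)
    have "v i = (\<Sum>m\<in>UNIV. v i $ m *s axis m 1)"
      by (simp add: basis_expansion)
    then have "v = v(i := \<Sum>m\<in>UNIV. v i $ m *s axis m 1)"
      by (simp add: fun_upd_idem)
    then have "\<omega> v = (\<Sum>m\<in>UNIV. v i $ m * \<omega> (v(i := axis m 1)))"
      using alternating_form_sum[OF alt, of UNIV v i "\<lambda>m. v i $ m" "\<lambda>m. axis m 1"] by simp
    moreover have "\<omega> (v(i := axis m 1)) = 0" for m
      using insert by (intro insert.IH) auto
    ultimately show ?case by simp
  qed
  from this[of UNIV] show ?thesis by simp
qed

lemma alternating_form_unique:
  fixes \<omega> \<eta> :: "('k::finite \<Rightarrow> 'a::field ^ 'm::finite) \<Rightarrow> 'a"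
  assumes alt: "alternating_form \<omega>" "alternating_form \<eta>" and \<sigma>: "bij \<sigma>"
    and basis: "\<eta> (\<lambda>k. axis (\<sigma> k) 1) = 1"
  shows "\<omega> v = \<omega> (\<lambda>k. axis (\<sigma> k) 1) * \<eta> v"
proof -
  let ?c = "\<omega> (\<lambda>k. axis (\<sigma> k) 1)"
  have "alternating_form (\<lambda>v. \<omega> v - ?c * \<eta> v)"
    using alternating_form_eq[OF alt(1)] alternating_form_eq[OF alt(2)]
    unfolding alternating_form_def
    by (simp add: alternating_form_add[OF alt(1)] alternating_form_add[OF alt(2)]
        alternating_form_scale[OF alt(1)] alternating_form_scale[OF alt(2)] algebra_simps)
  from alternating_form_eq_0[OF this \<sigma>, of v] basis show ?thesis by simp
qed

text \<open>Relabelling the coordinates along \<open>\<sigma>\<close> is a global chart whose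
  Jacobian columns are the axis vectors. It matches the integral points with a box of volume one, so
  their volume is the absolute value of the form on the basis, and this volume is 1 by
  normalization.\<close>

lemma unit_volume_form_basis:
  fixes \<omega> :: "('k::finite \<Rightarrow> 'a::nonarch_local_field ^ 'm::finite) \<Rightarrow> 'a"
  assumes haar: "normalized_haar_measure \<mu>" and unit: "unit_volume_form \<mu> \<omega>" and \<sigma>: "bij \<sigma>"
  shows "absval (\<omega> (\<lambda>k. axis (\<sigma> k) 1)) = 1"
proof -
  define \<psi> where "\<psi> t = (\<chi> i. t $ inv \<sigma> i)" for t :: "'a ^ 'k"
  define P :: "'a ^ 'k ^ 'm" where "P = (\<chi> i k. if i = \<sigma> k then 1 else 0)"
  have inv: "inv \<sigma> (\<sigma> k) = k" "\<sigma> (inv \<sigma> i) = i" for k i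
    using \<sigma> by (simp_all add: bij_is_inj bij_is_surj surj_f_inv_f)
  have P: "P *v h = \<psi> h" for h
  proof -
    have "(\<Sum>k\<in>UNIV. P $ i $ k * h $ k) = (\<Sum>k\<in>UNIV. if k = inv \<sigma> i then h $ k else 0)" for i
      by (intro sum.cong) (auto simp: P_def inv)
    then show ?thesis
      by (simp add: matrix_vector_mult_def \<psi>_def)
  qed
  have "has_jacobian \<psi> P t" for t
    by (rule has_jacobian_quadratic[where C = 0]) (simp add: P \<psi>_def)
  then have jac: "jacobian \<psi> t = P" for t
    by (rule jacobian_eq)
  have col: "column k P = axis (\<sigma> k) 1" for k
    by (auto simp: column_def P_def axis_def vec_eq_iff)
  have inj: "inj \<psi>"
    by (rule injI) (metis \<psi>_def inv(1) vec_eq_iff vec_lambda_beta)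
  have surj: "surj \<psi>"
  proof (rule surjI)
    show "\<psi> (\<chi> k. x $ \<sigma> k) = x" for x
      by (simp add: \<psi>_def inv)
  qed
  have "analytic_at \<psi> s" for s
  proof (rule analytic_at_polynomial)
    fix i
    have "(\<Prod>j\<in>UNIV. (t $ j - s $ j) ^ (if j = k then 1 else 0)) = t $ k - s $ k" for t k
    proof -
      have "(\<Prod>j\<in>UNIV. (t $ j - s $ j) ^ (if j = k then 1 else 0)) = (\<Prod>j\<in>UNIV. if j = k then t $ j - s $ j else 1)"
        by (intro prod.cong) auto
      then show ?thesis by simp
    qed
    then show "\<exists>L. \<forall>t. \<psi> t $ i = (\<Sum>(a, \<alpha>)\<leftarrow>L. a * (\<Prod>j\<in>UNIV. (t $ j - s $ j) ^ \<alpha> j))"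
      by (intro exI[of _ "[(s $ inv \<sigma> i, \<lambda>_. 0), (1, \<lambda>j. if j = inv \<sigma> i then 1 else 0)]"])
        (simp add: \<psi>_def)
  qed
  moreover have "homeomorphism UNIV (range \<psi>) \<psi> (\<lambda>x. \<chi> k. x $ \<sigma> k)"
    unfolding homeomorphism_def surj
  proof (intro conjI)
    show "continuous_on UNIV \<psi>" "continuous_on UNIV (\<lambda>x :: 'a ^ 'm. \<chi> k. x $ \<sigma> k)"
      unfolding \<psi>_def by (intro continuous_on_vec_lambda continuous_on_component continuous_on_id)+
    show "range (\<lambda>x :: 'a ^ 'm. \<chi> k. x $ \<sigma> k) = UNIV"
      by (rule surjI[of _ \<psi>]) (simp add: \<psi>_def inv)
  qed (auto simp: \<psi>_def inv)
  moreover have "inj ((*v) P)"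
    using inj by (simp add: inj_def P)
  ultimately have chart: "chart_on UNIV UNIV \<psi>"
    unfolding chart_on_def jac surj by auto
  obtain \<nu> where form: "form_measure \<mu> UNIV (\<lambda>_. \<omega>) \<nu>" and vol: "emeasure \<nu> integral_points = 1"
    using unit by (auto simp: unit_volume_form_def)
  let ?c = "ennreal (absval (\<omega> (\<lambda>k. axis (\<sigma> k) 1)))"
  let ?O = "ring_of_integers :: 'a set"
  have O: "?O \<in> sets borel"
    using closed_ring_of_integers by (rule borel_closed)
  have boxm: "{x :: 'a ^ 'm. \<forall>i. x $ i \<in> ?O} \<in> sets borel"
    "{t :: 'a ^ 'k. \<forall>i. t $ i \<in> ?O} \<in> sets borel"
    "emeasure (coordinate_measure \<mu>) {t :: 'a ^ 'k. \<forall>i. t $ i \<in> ?O} = 1"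
    using emeasure_coordinate_box[OF haar O] by (simp_all add: emeasure_ring_of_integers[OF haar])
  have "sets \<nu> = sets borel"
    using form by (simp add: form_measure_def)
  then have "emeasure \<nu> integral_points =
     (\<integral>\<^sup>+t\<in>{t. \<psi> t \<in> integral_points}. ?c \<partial>coordinate_measure \<mu>)"
    using form chart boxm surj unfolding form_measure_def
    by (fastforce simp: jac col integral_points_def)
  also have "{t. \<psi> t \<in> integral_points} = {t. \<forall>i. t $ i \<in> ?O}"
    using inv by (auto simp: integral_points_def \<psi>_def) metis
  also have "(\<integral>\<^sup>+t\<in>\<dots>. ?c \<partial>coordinate_measure \<mu>) = ?c"
    using boxm by (subst nn_integral_cmult_indicator) (auto simp: coordinate_measure_def)
  finally show ?thesis
    using vol by (simp flip: ennreal_1)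
qed

section \<open>The characteristic polynomial of a two-by-two matrix\<close>

lemma add_1_neq [simp]: "r + 1 \<noteq> r" "r \<noteq> r + 1" for r :: 2
  by simp_all

text \<open>Naming the two indices \<open>r\<close> and \<open>r + 1\<close> with \<open>r\<close>
  arbitrary lets each later formula be proved once and used for both charts of the projective
  line.\<close>

lemma range_2: "i = r \<or> i = r + 1" for i r :: 2
  using exhaust_2[of i] exhaust_2[of r] by auto

lemma UNIV_2x2: "(UNIV :: (2 \<times> 2) set) = {(r, r), (r, r + 1), (r + 1, r), (r + 1, r + 1)}"
  using range_2[of _ r] by auto

lemma forall_2x2: "(\<forall>p. P p) \<longleftrightarrow> P (r, r) \<and> P (r, r + 1) \<and> P (r + 1, r) \<and> P (r + 1, r + 1)"
  for P :: "2 \<times> 2 \<Rightarrow> bool"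
  using UNIV_2x2[of r] by (metis UNIV_I empty_iff insert_iff)

lemma sum_2x2: "(\<Sum>p\<in>UNIV. f p) = f (r, r) + f (r, r + 1) + f (r + 1, r) + f (r + 1, r + 1)"
  for f :: "2 \<times> 2 \<Rightarrow> 'b::comm_monoid_add"
  unfolding UNIV_2x2[of r] by (simp add: add.assoc)

lemma charpoly_2:
  "charpoly X = [:X $ r $ r * X $ (r + 1) $ (r + 1) - X $ r $ (r + 1) * X $ (r + 1) $ r,
    - (X $ r $ r + X $ (r + 1) $ (r + 1)), 1:]"
  for X :: "'a::comm_ring_1 ^ 2 ^ 2"
proof -
  have "charpoly X = [:X $ 1 $ 1 * X $ 2 $ 2 - X $ 1 $ 2 * X $ 2 $ 1, - (X $ 1 $ 1 + X $ 2 $ 2), 1:]"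
    by (simp add: charpoly_def det_2 mat_def map_matrix_def algebra_simps)
  moreover have "(2 :: 2) + 1 = 1"
    using exhaust_2[of "2 + 1"] add_1_neq[of 2] by blast
  ultimately show ?thesis
    using exhaust_2[of r] by (elim disjE) (simp_all only: one_add_one mult.commute add.commute)
qed

section \<open>Trace and determinant: the fibre and the derivative of the characteristic map\<close>

lemma char_map_eq:
  "char_map x = vector [- (x $ (r, r) + x $ (r + 1, r + 1)),
    x $ (r, r) * x $ (r + 1, r + 1) - x $ (r, r + 1) * x $ (r + 1, r)]"
  for x :: "'a::comm_ring_1 ^ (2 \<times> 2)"
  unfolding char_map_def charpoly_2[of _ r] by (simp add: point_matrix_def)

lemma char_fiber_eq:
  assumes "charpoly \<gamma> = [:- a, 1:] * [:- b, 1:]"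
  shows "char_fiber \<gamma> = {x. x $ (r, r) + x $ (r + 1, r + 1) = a + b \<and>
    x $ (r, r) * x $ (r + 1, r + 1) - x $ (r, r + 1) * x $ (r + 1, r) = a * b}"
proof -
  have "point_matrix (matrix_point \<gamma>) = \<gamma>"
    by (simp add: point_matrix_def matrix_point_def vec_eq_iff)
  then have "char_map (matrix_point \<gamma>) = vector [- (a + b), a * b]"
    by (simp add: char_map_def assms algebra_simps)
  then show ?thesis
    unfolding char_fiber_def char_map_eq[of _ r]
    by (simp only: vec_eq_iff forall_2 vector_2 neg_equal_iff_equal)
qed

text \<open>The first row is minus the trace of h; the second is the polarization of the
  determinant, that is, the trace of adj(x) h.\<close>

definition char_map_jacobian :: "2 \<Rightarrow> 'a::comm_ring_1 ^ (2 \<times> 2) \<Rightarrow> 'a ^ (2 \<times> 2) ^ 2" where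
  "char_map_jacobian r x = (\<chi> k p. if k = 1 then if p = (r, r) \<or> p = (r + 1, r + 1) then - 1 else 0
     else if p = (r, r) then x $ (r + 1, r + 1) else if p = (r + 1, r + 1) then x $ (r, r)
     else if p = (r, r + 1) then - x $ (r + 1, r) else - x $ (r, r + 1))"

lemma char_map_jacobian_apply:
  "(char_map_jacobian r x *v h) $ 1 = - (h $ (r, r) + h $ (r + 1, r + 1))"
  "(char_map_jacobian r x *v h) $ 2 = x $ (r + 1, r + 1) * h $ (r, r) + x $ (r, r) * h $ (r + 1, r + 1)
     - x $ (r + 1, r) * h $ (r, r + 1) - x $ (r, r + 1) * h $ (r + 1, r)"
  by (simp_all add: char_map_jacobian_def matrix_vector_mult_def sum_2x2[of _ r])

lemma absval_mult_le_dist: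
  "absval ((x $ i - y $ i) * (x $ j - y $ j)) \<le> (dist x y)\<^sup>2"
  for x y :: "'a::nonarch_local_field ^ 'm::finite"
  unfolding absval_mult power2_eq_square by (intro mult_mono absval_le_dist) auto

text \<open>The trace is linear, and the remainder of the determinant is the determinant of the
  increment. The ultrametric inequality bounds its two products without a factor 2, so the constant
  is 1.\<close>

lemma jacobian_char_map: "jacobian char_map x = char_map_jacobian r x"
  for x :: "'a::nonarch_local_field ^ (2 \<times> 2)"
proof (rule jacobian_eq, rule has_jacobian_quadratic[where C = 1])
  fix h :: "'a ^ (2 \<times> 2)" and i :: 2
  have "absval (h $ p * h $ q) \<le> (dist (x + h) x)\<^sup>2" for p q
    using absval_mult_le_dist[of "x + h" p x q] by simp
  then have "absval (h $ (r, r) * h $ (r + 1, r + 1) - h $ (r, r + 1) * h $ (r + 1, r)) \<le> (dist (x + h) x)\<^sup>2"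
    by (intro absval_diff_le) auto
  moreover have "char_map (x + h) $ 1 - char_map x $ 1 - (char_map_jacobian r x *v h) $ 1 = 0"
    by (simp add: char_map_eq[of _ r] char_map_jacobian_apply)
  moreover have "char_map (x + h) $ 2 - char_map x $ 2 - (char_map_jacobian r x *v h) $ 2
      = h $ (r, r) * h $ (r + 1, r + 1) - h $ (r, r + 1) * h $ (r + 1, r)"
    by (simp add: char_map_eq[of _ r] char_map_jacobian_apply algebra_simps)
  ultimately show "absval (char_map (x + h) $ i - char_map x $ i - (char_map_jacobian r x *v h) $ i)
      \<le> 1 * (dist (x + h) x)\<^sup>2"
    using exhaust_2[of i] by auto
qed


section \<open>Explicit volume forms\<close>

lemma alternating_form_det_2: "alternating_form (\<lambda>v :: 2 \<Rightarrow> 'a::field ^ 2. v 1 $ 1 * v 2 $ 2 - v 1 $ 2 * v 2 $ 1)"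
  unfolding alternating_form_def forall_2 by (auto simp: algebra_simps)

text \<open>These are the Pluecker coordinates of a pair of vectors. Pairing minors of the first two
  arguments with complementary minors of the last two matches the splitting in
  \<open>case_sum\<close> into fibre tangents and arbitrary vectors.\<close>

definition minor_2 :: "'m \<Rightarrow> 'm \<Rightarrow> 'a::comm_ring_1 ^ 'm::finite \<Rightarrow> 'a ^ 'm \<Rightarrow> 'a" where
  "minor_2 p q x y = x $ p * y $ q - x $ q * y $ p"

lemma minor_2_simps [simp]:
  "minor_2 p q (x + x') y = minor_2 p q x y + minor_2 p q x' y"
  "minor_2 p q x (y + y') = minor_2 p q x y + minor_2 p q x y'"
  "minor_2 p q (c *s x) y = c * minor_2 p q x y"
  "minor_2 p q x (c *s y) = c * minor_2 p q x y"
  "minor_2 p q x x = 0"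
  by (simp_all add: minor_2_def algebra_simps)

text \<open>Laplace expansion of a determinant of order four along its first two rows.\<close>

definition det_2x2 :: "2 \<Rightarrow> (2 + 2 \<Rightarrow> 'a::comm_ring_1 ^ (2 \<times> 2)) \<Rightarrow> 'a" where
  "det_2x2 r v = (let m = (\<lambda>p q. minor_2 p q (v (Inl 1)) (v (Inl 2))); n = (\<lambda>p q. minor_2 p q (v (Inr 1)) (v (Inr 2)))
     in m (r, r) (r, r + 1) * n (r + 1, r) (r + 1, r + 1)
      - m (r, r) (r + 1, r) * n (r, r + 1) (r + 1, r + 1)
      + m (r, r) (r + 1, r + 1) * n (r, r + 1) (r + 1, r)
      + m (r, r + 1) (r + 1, r) * n (r, r) (r + 1, r + 1)
      - m (r, r + 1) (r + 1, r + 1) * n (r, r) (r + 1, r)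
      + m (r + 1, r) (r + 1, r + 1) * n (r, r) (r, r + 1))"

lemma alternating_form_det_2x2: "alternating_form (det_2x2 r :: (2 + 2 \<Rightarrow> 'a::field ^ (2 \<times> 2)) \<Rightarrow> 'a)"
  unfolding alternating_form_def split_sum_all forall_2 det_2x2_def Let_def
  by (simp add: algebra_simps) (simp add: minor_2_def algebra_simps)

text \<open>The row by row order of the matrix entries, for which \<open>det_2x2\<close> takes the
  value 1 on the basis.\<close>

definition index_2x2 :: "2 \<Rightarrow> 2 + 2 \<Rightarrow> 2 \<times> 2" where
  "index_2x2 r k = (case k of Inl i \<Rightarrow> (r, if i = 1 then r else r + 1) | Inr i \<Rightarrow> (r + 1, if i = 1 then r else r + 1))"

lemma bij_index_2x2: "bij (index_2x2 r)"
proof -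
  have "{index_2x2 r (Inl 1), index_2x2 r (Inl 2), index_2x2 r (Inr 1), index_2x2 r (Inr 2)} = UNIV"
    unfolding UNIV_2x2[of r] by (simp add: index_2x2_def)
  then have surj: "surj (index_2x2 r)"
    by blast
  then have "inj (index_2x2 r)"
    by (intro eq_card_imp_inj_on) auto
  with surj show ?thesis by (simp add: bij_def)
qed

lemma det_2x2_basis: "det_2x2 r (\<lambda>k. axis (index_2x2 r k) 1) = (1 :: 'a::field)"
  by (simp add: det_2x2_def Let_def minor_2_def index_2x2_def axis_def)

text \<open>Top forms are unique up to a scalar, and the volume normalization makes that scalar a
  unit. The unknown form may therefore be replaced by an explicit determinant under absolute
  values.\<close>

lemma unit_volume_form_det_2x2:
  fixes \<omega> :: "(2 + 2 \<Rightarrow> 'a::nonarch_local_field ^ (2 \<times> 2)) \<Rightarrow> 'a"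
  assumes "normalized_haar_measure \<mu>" "unit_volume_form \<mu> \<omega>"
  obtains g where "absval g = 1" "\<And>v. \<omega> v = g * det_2x2 r v"
proof
  have "alternating_form \<omega>"
    using assms by (simp add: unit_volume_form_def)
  then show "\<omega> v = \<omega> (\<lambda>k. axis (index_2x2 r k) 1) * det_2x2 r v" for v
    by (rule alternating_form_unique[OF _ alternating_form_det_2x2 bij_index_2x2 det_2x2_basis])
qed (rule unit_volume_form_basis[OF assms bij_index_2x2])

lemma unit_volume_form_det_2:
  fixes \<omega> :: "(2 \<Rightarrow> 'a::nonarch_local_field ^ 2) \<Rightarrow> 'a"
  assumes "normalized_haar_measure \<mu>" "unit_volume_form \<mu> \<omega>"
  obtains h where "absval h = 1" "\<And>v. \<omega> v = h * (v 1 $ 1 * v 2 $ 2 - v 1 $ 2 * v 2 $ 1)"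
proof
  have "alternating_form \<omega>"
    using assms by (simp add: unit_volume_form_def)
  then show "\<omega> v = \<omega> (\<lambda>k. axis (id k) 1) * (v 1 $ 1 * v 2 $ 2 - v 1 $ 2 * v 2 $ 1)" for v
    by (rule alternating_form_unique[OF _ alternating_form_det_2 bij_id]) (simp add: axis_def)
qed (rule unit_volume_form_basis[OF assms bij_id])

section \<open>Charts of the fibre\<close>

text \<open>The second premise exhibits vectors \<open>w\<close> on which the pulled back form does
  not vanish, so that \<open>f\<close> is a submersion at \<open>X\<close> and the factor can be
  cancelled.\<close>

lemma quotient_form_eqI:
  assumes "\<And>v. \<omega>\<^sub>V (case_sum u v) = c * \<omega>\<^sub>W (\<lambda>i. jacobian f X *v v i)"
    and "\<omega>\<^sub>W (\<lambda>i. jacobian f X *v w i) \<noteq> 0"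
  shows "quotient_form f \<omega>\<^sub>V \<omega>\<^sub>W X u = c"
  unfolding quotient_form_def
proof (rule the_equality)
  fix c' assume "\<forall>v. \<omega>\<^sub>V (case_sum u v) = c' * \<omega>\<^sub>W (\<lambda>i. jacobian f X *v v i)"
  then have "c' * \<omega>\<^sub>W (\<lambda>i. jacobian f X *v w i) = c * \<omega>\<^sub>W (\<lambda>i. jacobian f X *v w i)"
    using assms(1)[of w] by simp
  with assms(2) show "c' = c" by simp
qed (use assms(1) in blast)

text \<open>Near a point of the set, |f| is constant by the isosceles principle and \<open>g\<close>
  moves by less than \<rho> |f|, so the bound persists. A non-strict inequality thus defines an open
  set, as the openness of chart images requires.\<close>

lemma open_dominated:
  fixes f g :: "'a::nonarch_local_field ^ 'm::finite \<Rightarrow> 'a"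
  assumes f: "continuous_on UNIV f" and g: "continuous_on UNIV g" and \<rho>: "\<rho> > 0"
  shows "open {x. f x \<noteq> 0 \<and> absval (g x) \<le> \<rho> * absval (f x)}"
proof (subst open_subopen, intro ballI)
  fix x assume "x \<in> {x. f x \<noteq> 0 \<and> absval (g x) \<le> \<rho> * absval (f x)}"
  then have x: "f x \<noteq> 0" "absval (g x) \<le> \<rho> * absval (f x)" by auto
  have op: "open {y. absval (k y - k x) < e}" if "continuous_on UNIV k" for k :: "'a ^ 'm \<Rightarrow> 'a" and e
  proof -
    have "{y. absval (k y - k x) < e} = k -` ball (k x) e"
      by (auto simp: dist_absval absval_minus_commute)
    then show ?thesis
      using continuous_on_open_vimage[OF open_UNIV, of k] that by auto
  qed
  let ?T = "{y. absval (f y - f x) < absval (f x)} \<inter> {y. absval (g y - g x) < \<rho> * absval (f x)}"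
  have "y \<in> {x. f x \<noteq> 0 \<and> absval (g x) \<le> \<rho> * absval (f x)}" if "y \<in> ?T" for y
  proof -
    have eq: "absval (f y) = absval (f x)"
      using that by (intro absval_eq_of_dist_less) auto
    then have "f y \<noteq> 0" using x(1) by (metis absval_eq_0)
    moreover have "absval (g y) \<le> \<rho> * absval (f x)"
      using that x(2) absval_add_le[of "g y - g x" "\<rho> * absval (f x)" "g x"] by simp
    ultimately show ?thesis by (simp add: eq)
  qed
  moreover have "open ?T" using op f g by (intro open_Int) auto
  moreover have "x \<in> ?T" using x \<rho> by simp
  ultimately show "\<exists>T. open T \<and> x \<in> T \<and> T \<subseteq> {x. f x \<noteq> 0 \<and> absval (g x) \<le> \<rho> * absval (f x)}"
    by blast
qed

text \<open>The matrix with \<open>a\<close>-eigenspace spanned by \<open>e\<^sub>r + s e\<^sub>r\<^sub>+\<^sub>1\<close>, trace \<open>a + b\<close> and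
  \<open>(r, r + 1)\<close>-entry \<open>y\<close>, where \<open>s = t $ 1\<close> and \<open>y = t $ 2\<close>: the fibre is an affine line bundle
  over the projective line of \<open>a\<close>-eigenspaces, which is trivial over the two standard affine
  charts. Indices of type \<open>2\<close> are taken modulo two.\<close>

definition eigenline_chart :: "'a::comm_ring_1 \<Rightarrow> 'a \<Rightarrow> 2 \<Rightarrow> 'a ^ 2 \<Rightarrow> 'a ^ (2 \<times> 2)" where
  "eigenline_chart a b r t = (\<chi> p. if p = (r, r) then a - t $ 1 * t $ 2
     else if p = (r, r + 1) then t $ 2
     else if p = (r + 1, r) then t $ 1 * (a - b) - (t $ 1)\<^sup>2 * t $ 2
     else b + t $ 1 * t $ 2)"

text \<open>The entries solve X (e_r + s e_{r+1}) = a (e_r + s e_{r+1}): the first row gives a - s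
  y, the trace then gives b + s y, and the second row gives s a - s (b + s y).\<close>

lemma eigenline_chart_simps [simp]:
  "eigenline_chart a b r t $ (r, r) = a - t $ 1 * t $ 2"
  "eigenline_chart a b r t $ (r, r + 1) = t $ 2"
  "eigenline_chart a b r t $ (r + 1, r) = t $ 1 * (a - b) - (t $ 1)\<^sup>2 * t $ 2"
  "eigenline_chart a b r t $ (r + 1, r + 1) = b + t $ 1 * t $ 2"
  by (simp_all add: eigenline_chart_def)

section \<open>Derivative and analyticity of the eigenline parametrization\<close>

definition eigenline_jacobian :: "'a::comm_ring_1 \<Rightarrow> 'a \<Rightarrow> 2 \<Rightarrow> 'a ^ 2 \<Rightarrow> 'a ^ 2 ^ (2 \<times> 2)" where
  "eigenline_jacobian a b r t = (\<chi> p k.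
     if p = (r, r) then if k = 1 then - t $ 2 else - t $ 1
     else if p = (r, r + 1) then if k = 1 then 0 else 1
     else if p = (r + 1, r) then if k = 1 then (a - b) - 2 * t $ 1 * t $ 2 else - (t $ 1)\<^sup>2
     else if k = 1 then t $ 2 else t $ 1)"

lemma eigenline_jacobian_apply [simp]:
  "(eigenline_jacobian a b r t *v h) $ (r, r) = - (t $ 2 * h $ 1 + t $ 1 * h $ 2)"
  "(eigenline_jacobian a b r t *v h) $ (r, r + 1) = h $ 2"
  "(eigenline_jacobian a b r t *v h) $ (r + 1, r) = ((a - b) - 2 * t $ 1 * t $ 2) * h $ 1 - (t $ 1)\<^sup>2 * h $ 2"
  "(eigenline_jacobian a b r t *v h) $ (r + 1, r + 1) = t $ 2 * h $ 1 + t $ 1 * h $ 2"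
  by (simp_all add: eigenline_jacobian_def matrix_vector_mult_def sum_2)

lemma jacobian_eigenline_chart: "jacobian (eigenline_chart a b r) t = eigenline_jacobian a b r t"
  for t :: "'a::nonarch_local_field ^ 2"
proof (rule jacobian_eq)
  \<comment> \<open>Only the entry (r + 1, r) has a remainder of three terms; the summands of
    \<open>C\<close> bound its two quadratic terms and, through |h_2| \<le> 1, its cubic one, which
    accounts for the 1.\<close>
  define C where "C = 1 + absval (t $ 2) + absval (2 * t $ 1)"
  show "has_jacobian (eigenline_chart a b r) (eigenline_jacobian a b r t) t"
  proof (rule has_jacobian_quadratic[where C = C])
    fix h :: "'a ^ 2" and p
    assume h: "\<And>j. absval (h $ j) \<le> 1"
    let ?d = "(dist (t + h) t)\<^sup>2"
    let ?rem = "\<lambda>p. eigenline_chart a b r (t + h) $ p - eigenline_chart a b r t $ p - (eigenline_jacobian a b r t *v h) $ p"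
    have hh: "absval (h $ i * h $ j) \<le> ?d" for i j
      using absval_mult_le_dist[of "t + h" i t j] by simp
    have d: "?d \<le> C * ?d" "0 \<le> C * ?d"
      by (auto simp: C_def distrib_right)
    have "absval (h $ 1 * h $ 2) \<le> C * ?d"
      using hh d(1) order_trans by blast
    moreover have "absval (t $ 2 * (h $ 1 * h $ 1) + 2 * t $ 1 * (h $ 1 * h $ 2) + h $ 2 * (h $ 1 * h $ 1)) \<le> C * ?d"
    proof -
      have c: "absval (c * (h $ i * h $ j)) \<le> absval c * ?d" for c i j
        unfolding absval_mult[of c] using hh by (intro mult_left_mono) auto
      have "absval (h $ 2 * (h $ 1 * h $ 1)) \<le> 1 * ?d"
        using c[of "h $ 2" 1 1] mult_right_mono[OF h[of 2], of ?d] by simp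
      then show ?thesis
        using c[of "t $ 2" 1 1] c[of "2 * t $ 1" 1 2]
          absval_triangle[of "t $ 2 * (h $ 1 * h $ 1)" "2 * t $ 1 * (h $ 1 * h $ 2)"]
          absval_triangle[of "t $ 2 * (h $ 1 * h $ 1) + 2 * t $ 1 * (h $ 1 * h $ 2)" "h $ 2 * (h $ 1 * h $ 1)"]
        by (simp add: C_def distrib_right)
    qed
    moreover have "?rem (r, r) = - (h $ 1 * h $ 2)" "?rem (r, r + 1) = 0"
      "?rem (r + 1, r + 1) = h $ 1 * h $ 2"
      "?rem (r + 1, r) = - (t $ 2 * (h $ 1 * h $ 1) + 2 * t $ 1 * (h $ 1 * h $ 2) + h $ 2 * (h $ 1 * h $ 1))"
      by (simp_all only: eigenline_chart_simps eigenline_jacobian_apply vector_add_component)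
        (simp_all add: algebra_simps power2_eq_square)
    ultimately have "\<forall>p. absval (?rem p) \<le> C * ?d"
      unfolding forall_2x2[of _ r] using d(2) by (simp only: absval_minus absval_0)
    then show "absval (?rem p) \<le> C * ?d" ..
  qed
qed

lemma analytic_at_eigenline_chart: "analytic_at (eigenline_chart a b r) s"
  for s :: "'a::nonarch_local_field ^ 2"
proof (rule analytic_at_polynomial)
  \<comment> \<open>\<open>m i j\<close> is the exponent of
    \<open>(t $ 1 - s $ 1) ^ i * (t $ 2 - s $ 2) ^ j\<close>; the lists below are the Taylor
    expansions of the four entries at \<open>s\<close>.\<close>
  define m :: "nat \<Rightarrow> nat \<Rightarrow> 2 \<Rightarrow> nat" where "m i j k = (if k = 1 then i else j)" for i j k
  have prod: "(\<Prod>k\<in>UNIV. (t $ k - s $ k) ^ m i j k) = (t $ 1 - s $ 1) ^ i * (t $ 2 - s $ 2) ^ j" for t i j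
    by (simp add: UNIV_2 m_def)
  have "\<forall>p. \<exists>L. \<forall>t. eigenline_chart a b r t $ p = (\<Sum>(c, \<alpha>)\<leftarrow>L. c * (\<Prod>k\<in>UNIV. (t $ k - s $ k) ^ \<alpha> k))"
    unfolding forall_2x2[of _ r]
  proof (intro conjI)
    show "\<exists>L. \<forall>t. eigenline_chart a b r t $ (r, r) = (\<Sum>(c, \<alpha>)\<leftarrow>L. c * (\<Prod>k\<in>UNIV. (t $ k - s $ k) ^ \<alpha> k))"
      by (rule exI[of _ "[(a - s $ 1 * s $ 2, m 0 0), (- s $ 2, m 1 0), (- s $ 1, m 0 1), (- 1, m 1 1)]"])
        (simp only: eigenline_chart_simps, simp add: prod algebra_simps)
    show "\<exists>L. \<forall>t. eigenline_chart a b r t $ (r, r + 1) = (\<Sum>(c, \<alpha>)\<leftarrow>L. c * (\<Prod>k\<in>UNIV. (t $ k - s $ k) ^ \<alpha> k))"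
      by (rule exI[of _ "[(s $ 2, m 0 0), (1, m 0 1)]"]) (simp only: eigenline_chart_simps, simp add: prod algebra_simps)
    show "\<exists>L. \<forall>t. eigenline_chart a b r t $ (r + 1, r) = (\<Sum>(c, \<alpha>)\<leftarrow>L. c * (\<Prod>k\<in>UNIV. (t $ k - s $ k) ^ \<alpha> k))"
      by (rule exI[of _ "[(s $ 1 * (a - b) - (s $ 1)\<^sup>2 * s $ 2, m 0 0), (a - b - 2 * s $ 1 * s $ 2, m 1 0),
          (- (s $ 1)\<^sup>2, m 0 1), (- s $ 2, m 2 0), (- 2 * s $ 1, m 1 1), (- 1, m 2 1)]"])
        (simp only: eigenline_chart_simps, simp add: prod algebra_simps power2_eq_square)
    show "\<exists>L. \<forall>t. eigenline_chart a b r t $ (r + 1, r + 1) = (\<Sum>(c, \<alpha>)\<leftarrow>L. c * (\<Prod>k\<in>UNIV. (t $ k - s $ k) ^ \<alpha> k))"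
      by (rule exI[of _ "[(b + s $ 1 * s $ 2, m 0 0), (s $ 2, m 1 0), (s $ 1, m 0 1), (1, m 1 1)]"])
        (simp only: eigenline_chart_simps, simp add: prod algebra_simps)
  qed
  then show "\<exists>L. \<forall>t. eigenline_chart a b r t $ p = (\<Sum>(c, \<alpha>)\<leftarrow>L. c * (\<Prod>k\<in>UNIV. (t $ k - s $ k) ^ \<alpha> k))" for p ..
qed

definition eigenline_box :: "real \<Rightarrow> ('a::nonarch_local_field ^ 2) set" where
  "eigenline_box \<rho> = {t. absval (t $ 1) \<le> \<rho> \<and> absval (t $ 2) \<le> 1}"

section \<open>The eigenline parametrization as a chart of the fibre\<close>

context
  fixes a b :: "'a::nonarch_local_field" and r :: 2 and \<rho> :: real
  assumes ab: "a \<noteq> b" and \<rho>: "0 < \<rho>" "\<rho> \<le> 1"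
begin

lemma open_eigenline_box: "open (eigenline_box \<rho> :: ('a ^ 2) set)"
proof -
  \<comment> \<open>The constant function 1 as dominating function turns a plain bound on a
    coordinate into an instance of \<open>open_dominated\<close>.\<close>
  have "open {x :: 'a ^ 2. (1::'a) \<noteq> 0 \<and> absval (x $ i) \<le> e * absval (1::'a)}" if "e > 0" for e i
    using that by (intro open_dominated continuous_on_const continuous_on_component continuous_on_id)
  from open_Int[OF this[OF \<rho>(1), of 1] this[of 1 2]] show ?thesis
    by (simp add: eigenline_box_def Collect_conj_eq)
qed

text \<open>The eigenspace parameter can be recovered without dividing by an entry of the matrix,
  because \<open>(s - s')(a - b)\<close> is a combination of differences of entries.\<close>

lemma eigenline_chart_dist:
  assumes "t \<in> eigenline_box \<rho>" "t' \<in> eigenline_box \<rho>"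
  shows "dist t t' \<le> (1 / absval (a - b) + 1) * dist (eigenline_chart a b r t) (eigenline_chart a b r t')"
proof -
  let ?X = "eigenline_chart a b r t" and ?X' = "eigenline_chart a b r t'"
  let ?d = "dist ?X ?X'"
  let ?s = "t $ 1" and ?s' = "t' $ 1"
  have s: "absval ?s \<le> 1" "absval ?s' \<le> 1"
    using assms \<rho> by (auto simp: eigenline_box_def)
  have le: "absval (c * (?X $ p - ?X' $ p)) \<le> ?d" if "absval c \<le> 1" for c p
    using mult_mono[OF that absval_le_dist[of ?X p ?X']] by (simp add: absval_mult)
  \<comment> \<open>The coefficients 1, s', s and s s' are integral, so the ultrametric inequality
    bounds the whole combination by the distance of the two matrices.\<close>
  have eq: "(?s - ?s') * (a - b) = 1 * (?X $ (r + 1, r) - ?X' $ (r + 1, r)) - ?s' * (?X $ (r, r) - ?X' $ (r, r))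
      + (?s * (?X $ (r + 1, r + 1) - ?X' $ (r + 1, r + 1)) - (?s * ?s') * (?X $ (r, r + 1) - ?X' $ (r, r + 1)))"
    unfolding eigenline_chart_simps by (simp add: algebra_simps power2_eq_square)
  have "absval (?s - ?s') * absval (a - b) \<le> ?d"
    unfolding absval_mult[symmetric] eq using s by (intro absval_add_le absval_diff_le le) (auto simp: absval_mult intro: mult_le_one)
  then have "absval (?s - ?s') \<le> ?d / absval (a - b)"
    using ab pos_le_divide_eq[of "absval (a - b)"] by simp
  moreover have "absval (t $ 2 - t' $ 2) \<le> ?d"
    using le[of 1 "(r, r + 1)"] by simp
  ultimately show ?thesis
    using dist_le_sum_absval[of t t'] by (simp add: sum_2 algebra_simps)
qed

text \<open>Since (X - a)(X - b) = 0, both columns of X - b lie on the a-eigenline, so any column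
  with nonzero upper entry determines \<open>s\<close> as a ratio. The two alternatives are the two
  columns; each is an open condition, which is the purpose of this description.\<close>

lemma eigenline_chart_image:
  "eigenline_chart a b r ` eigenline_box \<rho> =
    {x. x $ (r, r) + x $ (r + 1, r + 1) = a + b \<and>
      x $ (r, r) * x $ (r + 1, r + 1) - x $ (r, r + 1) * x $ (r + 1, r) = a * b \<and>
      absval (x $ (r, r + 1)) \<le> 1 \<and>
      (x $ (r, r) - b \<noteq> 0 \<and> absval (x $ (r + 1, r)) \<le> \<rho> * absval (x $ (r, r) - b) \<or>
       x $ (r, r + 1) \<noteq> 0 \<and> absval (x $ (r + 1, r + 1) - b) \<le> \<rho> * absval (x $ (r, r + 1)))}"
  (is "_ = ?R")
proof (intro equalityI subsetI)
  fix x assume "x \<in> eigenline_chart a b r ` eigenline_box \<rho>"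
  then obtain t where t: "absval (t $ 1) \<le> \<rho>" "absval (t $ 2) \<le> 1" and x: "x = eigenline_chart a b r t"
    by (auto simp: eigenline_box_def)
  have eq: "x $ (r + 1, r) = t $ 1 * (x $ (r, r) - b)" "x $ (r + 1, r + 1) - b = t $ 1 * x $ (r, r + 1)"
    "x $ (r, r) - b = (a - b) - t $ 1 * x $ (r, r + 1)"
    unfolding x eigenline_chart_simps by (simp_all add: algebra_simps power2_eq_square)
  \<comment> \<open>If both upper entries vanished, \<open>eq(3)\<close> would read
    \<open>0 = a - b\<close>.\<close>
  have "x $ (r, r) - b \<noteq> 0 \<or> x $ (r, r + 1) \<noteq> 0"
    using ab eq(3) by auto
  moreover have "x $ (r, r) + x $ (r + 1, r + 1) = a + b"
    "x $ (r, r) * x $ (r + 1, r + 1) - x $ (r, r + 1) * x $ (r + 1, r) = a * b"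
    unfolding x eigenline_chart_simps by (simp_all add: algebra_simps power2_eq_square)
  ultimately show "x \<in> ?R"
    unfolding mem_Collect_eq eq(1,2) absval_mult using t by (auto simp: x intro!: mult_right_mono)
next
  fix x assume "x \<in> ?R"
  then have tr: "x $ (r, r) + x $ (r + 1, r + 1) = a + b"
    and det: "x $ (r, r) * x $ (r + 1, r + 1) - x $ (r, r + 1) * x $ (r + 1, r) = a * b"
    and y: "absval (x $ (r, r + 1)) \<le> 1"
    and dom: "x $ (r, r) - b \<noteq> 0 \<and> absval (x $ (r + 1, r)) \<le> \<rho> * absval (x $ (r, r) - b) \<or>
       x $ (r, r + 1) \<noteq> 0 \<and> absval (x $ (r + 1, r + 1) - b) \<le> \<rho> * absval (x $ (r, r + 1))"
    by auto
  have a: "a = x $ (r, r) + x $ (r + 1, r + 1) - b" using tr by (simp add: algebra_simps)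
  \<comment> \<open>This is det(X - b) = 0: the columns of X - b are proportional, so the ratio read
    off from one column also satisfies the equation of the other.\<close>
  have rank: "(x $ (r, r) - b) * (x $ (r + 1, r + 1) - b) = x $ (r, r + 1) * x $ (r + 1, r)"
    using det unfolding a by (simp add: algebra_simps)
  have "\<exists>s. absval s \<le> \<rho> \<and> s * x $ (r, r + 1) = x $ (r + 1, r + 1) - b \<and> s * (x $ (r, r) - b) = x $ (r + 1, r)"
    using dom
  proof (elim disjE conjE)
    assume *: "x $ (r, r) - b \<noteq> 0" "absval (x $ (r + 1, r)) \<le> \<rho> * absval (x $ (r, r) - b)"
    then show ?thesis
      using rank
      by (intro exI[of _ "x $ (r + 1, r) / (x $ (r, r) - b)"])
        (simp add: absval_divide pos_divide_le_eq nonzero_divide_eq_eq nonzero_eq_divide_eq mult.commute)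
  next
    assume *: "x $ (r, r + 1) \<noteq> 0" "absval (x $ (r + 1, r + 1) - b) \<le> \<rho> * absval (x $ (r, r + 1))"
    then show ?thesis
      using rank
      by (intro exI[of _ "(x $ (r + 1, r + 1) - b) / x $ (r, r + 1)"])
        (simp add: absval_divide pos_divide_le_eq nonzero_divide_eq_eq nonzero_eq_divide_eq mult.commute)
  qed
  then obtain s where s: "absval s \<le> \<rho>" "s * x $ (r, r + 1) = x $ (r + 1, r + 1) - b"
    "s * (x $ (r, r) - b) = x $ (r + 1, r)"
    by blast
  have diff: "x $ (r, r) - b = (a - b) - s * x $ (r, r + 1)"
    using s(2) by (simp add: a)
  let ?t = "vector [s, x $ (r, r + 1)] :: 'a ^ 2"
  have "s * (a - b) - s\<^sup>2 * x $ (r, r + 1) = x $ (r + 1, r)"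
    unfolding s(3)[symmetric] diff by (simp add: algebra_simps power2_eq_square)
  then have "x = eigenline_chart a b r ?t"
    unfolding vec_eq_iff forall_2x2[of _ r] using s(2) by (simp add: a)
  moreover have "?t \<in> eigenline_box \<rho>"
    using s y by (simp add: eigenline_box_def)
  ultimately show "x \<in> eigenline_chart a b r ` eigenline_box \<rho>" by blast
qed

lemma chart_on_eigenline_chart:
  assumes \<gamma>: "charpoly \<gamma> = [:- a, 1:] * [:- b, 1:]"
  shows "chart_on (char_fiber \<gamma>) (eigenline_box \<rho>) (eigenline_chart a b r)"
proof -
  let ?\<psi> = "eigenline_chart a b r" and ?V = "eigenline_box \<rho> :: ('a ^ 2) set"
  let ?K = "1 / absval (a - b) + 1"
  let ?U = "{x :: 'a ^ (2 \<times> 2). (1::'a) \<noteq> 0 \<and> absval (x $ (r, r + 1)) \<le> 1 * absval (1::'a)} \<inter>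
      ({x. x $ (r, r) - b \<noteq> 0 \<and> absval (x $ (r + 1, r)) \<le> \<rho> * absval (x $ (r, r) - b)} \<union>
       {x. x $ (r, r + 1) \<noteq> 0 \<and> absval (x $ (r + 1, r + 1) - b) \<le> \<rho> * absval (x $ (r, r + 1))})"
  have "open ?U"
    using \<rho> by (intro open_Int open_Un open_dominated continuous_on_const continuous_on_diff
        continuous_on_component continuous_on_id) auto
  moreover have "?\<psi> ` ?V = char_fiber \<gamma> \<inter> ?U"
    unfolding eigenline_chart_image char_fiber_eq[OF \<gamma>, of r] by auto
  ultimately have "openin (top_of_set (char_fiber \<gamma>)) (?\<psi> ` ?V)"
    by (auto simp: openin_open)
  moreover have "inj ((*v) (eigenline_jacobian a b r t))" for t
  proof (rule injI)
    fix h h' assume eq: "eigenline_jacobian a b r t *v h = eigenline_jacobian a b r t *v h'"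
    have 2: "h $ 2 = h' $ 2"
      using arg_cong[OF eq, of "\<lambda>x. x $ (r, r + 1)"] by simp
    have "t $ 2 * (h $ 1 - h' $ 1) = 0"
      using arg_cong[OF eq, of "\<lambda>x. x $ (r + 1, r + 1)", unfolded eigenline_jacobian_apply] 2
      by (simp add: algebra_simps)
    moreover have "((a - b) - 2 * t $ 1 * t $ 2) * (h $ 1 - h' $ 1) = 0"
      using arg_cong[OF eq, of "\<lambda>x. x $ (r + 1, r)", unfolded eigenline_jacobian_apply] 2
      by (simp add: algebra_simps)
    \<comment> \<open>Either \<open>t $ 2\<close> is nonzero, or the factor in the second equation
      reduces to \<open>a - b\<close>.\<close>
    ultimately have "h $ 1 = h' $ 1"
      using ab by auto
    with 2 show "h = h'" by (simp add: vec_eq_iff forall_2)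
  qed
  \<comment> \<open>The estimate \<open>eigenline_chart_dist\<close> provides both injectivity and a
    Lipschitz bound \<open>?K\<close> for the inverse.\<close>
  moreover have "homeomorphism ?V (?\<psi> ` ?V) ?\<psi> (inv_into ?V ?\<psi>)"
  proof -
    have K: "?K > 0" using ab by (intro add_nonneg_pos) auto
    have inj: "inj_on ?\<psi> ?V"
      using eigenline_chart_dist by (intro inj_onI) (metis dist_le_zero_iff dist_self mult_zero_right)
    have "\<forall>p. continuous_on UNIV (\<lambda>t. ?\<psi> t $ p)"
      unfolding forall_2x2[of _ r] eigenline_chart_simps power2_eq_square
      by (intro conjI continuous_intros)
    then have "continuous_on UNIV (\<lambda>t. \<chi> p. ?\<psi> t $ p)"
      by (intro continuous_on_vec_lambda) (rule spec)
    then have "continuous_on UNIV ?\<psi>"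
      by (simp only: vec_lambda_eta)
    moreover have "continuous_on (?\<psi> ` ?V) (inv_into ?V ?\<psi>)"
      unfolding continuous_on_iff
    proof (intro ballI allI impI)
      fix x and e :: real assume x: "x \<in> ?\<psi> ` ?V" and e: "e > 0"
      have "dist (inv_into ?V ?\<psi> x') (inv_into ?V ?\<psi> x) < e"
        if "x' \<in> ?\<psi> ` ?V" "dist x' x < e / ?K" for x'
      proof -
        have "dist (inv_into ?V ?\<psi> x') (inv_into ?V ?\<psi> x) \<le> ?K * dist x' x"
          using eigenline_chart_dist[OF inv_into_into[OF that(1)] inv_into_into[OF x]]
          by (simp only: f_inv_into_f[OF that(1)] f_inv_into_f[OF x])
        also have "\<dots> < e"
          using that(2) K by (simp add: pos_less_divide_eq mult.commute)
        finally show ?thesis .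
      qed
      then show "\<exists>d>0. \<forall>x'\<in>?\<psi> ` ?V. dist x' x < d \<longrightarrow> dist (inv_into ?V ?\<psi> x') (inv_into ?V ?\<psi> x) < e"
        using e K by (intro exI[of _ "e / ?K"]) auto
    qed
    ultimately show ?thesis
      using inj by (auto simp: homeomorphism_def inv_into_f_f f_inv_into_f image_iff
          intro: continuous_on_subset)
  qed
  ultimately show ?thesis
    unfolding chart_on_def
    using open_eigenline_box analytic_at_eigenline_chart by (auto simp: jacobian_eigenline_chart)
qed

end

text \<open>The wedge of the two coordinate tangent vectors with \<open>v\<close> is exactly the
  determinant of the images of \<open>v\<close> under the derivative of the characteristic map. No
  power of \<open>a - b\<close> is left over, so the quotient of the standard forms pulls back to ds
  \<and> dy.\<close>

lemma det_2x2_eigenline: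
  "det_2x2 r (case_sum (\<lambda>j. column j (eigenline_jacobian a b r t)) v) =
    (char_map_jacobian r (eigenline_chart a b r t) *v v 1) $ 1 * (char_map_jacobian r (eigenline_chart a b r t) *v v 2) $ 2
    - (char_map_jacobian r (eigenline_chart a b r t) *v v 1) $ 2 * (char_map_jacobian r (eigenline_chart a b r t) *v v 2) $ 1"
proof -
  have col: "column 1 (eigenline_jacobian a b r t) $ (r, r) = - t $ 2"
    "column 1 (eigenline_jacobian a b r t) $ (r, r + 1) = 0"
    "column 1 (eigenline_jacobian a b r t) $ (r + 1, r) = (a - b) - 2 * t $ 1 * t $ 2"
    "column 1 (eigenline_jacobian a b r t) $ (r + 1, r + 1) = t $ 2"
    "column 2 (eigenline_jacobian a b r t) $ (r, r) = - t $ 1"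
    "column 2 (eigenline_jacobian a b r t) $ (r, r + 1) = 1"
    "column 2 (eigenline_jacobian a b r t) $ (r + 1, r) = - (t $ 1)\<^sup>2"
    "column 2 (eigenline_jacobian a b r t) $ (r + 1, r + 1) = t $ 1"
    by (simp_all add: column_def eigenline_jacobian_def)
  show ?thesis
    unfolding det_2x2_def Let_def minor_2_def sum.case col char_map_jacobian_apply eigenline_chart_simps
    by (simp add: algebra_simps power2_eq_square)
qed

lemma absval_quotient_form_eigenline:
  fixes a b :: "'a::nonarch_local_field" and \<omega>\<^sub>g\<^sub>l :: "(2 + 2 \<Rightarrow> 'a ^ (2 \<times> 2)) \<Rightarrow> 'a"
    and \<omega>\<^sub>A :: "(2 \<Rightarrow> 'a ^ 2) \<Rightarrow> 'a"
  assumes haar: "normalized_haar_measure \<mu>" and gl: "unit_volume_form \<mu> \<omega>\<^sub>g\<^sub>l" and A: "unit_volume_form \<mu> \<omega>\<^sub>A"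
    and ab: "a \<noteq> b"
  shows "absval (quotient_form char_map \<omega>\<^sub>g\<^sub>l \<omega>\<^sub>A (eigenline_chart a b r t)
    (\<lambda>j. column j (jacobian (eigenline_chart a b r) t))) = 1"
proof -
  obtain g where g: "absval g = 1" "\<And>v. \<omega>\<^sub>g\<^sub>l v = g * det_2x2 r v"
    using unit_volume_form_det_2x2[OF haar gl] by blast
  obtain h where h: "absval h = 1" "\<And>v. \<omega>\<^sub>A v = h * (v 1 $ 1 * v 2 $ 2 - v 1 $ 2 * v 2 $ 1)"
    using unit_volume_form_det_2[OF haar A] by blast
  have h0: "h \<noteq> 0" using h(1) by auto
  let ?x = "eigenline_chart a b r t"
  let ?J = "char_map_jacobian r ?x"
  \<comment> \<open>Vectors witnessing that the characteristic map is a submersion: the determinant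
    of their images is \<open>b - a\<close> if \<open>t $ 2 = 0\<close> and \<open>- t $ 2\<close>
    otherwise.\<close>
  define w :: "2 \<Rightarrow> 'a ^ (2 \<times> 2)" where
    "w i = (if i = 1 then if t $ 2 = 0 then axis (r, r) 1 else axis (r + 1, r) 1 else axis (r + 1, r + 1) 1)" for i
  have "quotient_form char_map \<omega>\<^sub>g\<^sub>l \<omega>\<^sub>A ?x (\<lambda>j. column j (eigenline_jacobian a b r t)) = g / h"
  proof (rule quotient_form_eqI)
    show "\<omega>\<^sub>g\<^sub>l (case_sum (\<lambda>j. column j (eigenline_jacobian a b r t)) v)
        = g / h * \<omega>\<^sub>A (\<lambda>i. jacobian char_map ?x *v v i)" for v
      using h0 by (simp add: g(2) h(2) jacobian_char_map[of _ r] det_2x2_eigenline)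
    have "(?J *v w 1) $ 1 * (?J *v w 2) $ 2 - (?J *v w 1) $ 2 * (?J *v w 2) $ 1 \<noteq> 0"
      unfolding char_map_jacobian_apply eigenline_chart_simps w_def using ab by (simp add: axis_def)
    then show "\<omega>\<^sub>A (\<lambda>i. jacobian char_map ?x *v w i) \<noteq> 0"
      using h0 by (simp add: h(2) jacobian_char_map[of _ r])
  qed
  then show ?thesis
    by (simp add: jacobian_eigenline_chart absval_divide g(1) h(1))
qed

text \<open>The density is constantly one on the box, so the image has the volume of the box; its
  second side is the ring of integers and contributes the factor 1.\<close>

lemma emeasure_eigenline_chart_image:
  fixes a b :: "'a::nonarch_local_field" and \<omega>\<^sub>g\<^sub>l :: "(2 + 2 \<Rightarrow> 'a ^ (2 \<times> 2)) \<Rightarrow> 'a"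
    and \<omega>\<^sub>A :: "(2 \<Rightarrow> 'a ^ 2) \<Rightarrow> 'a"
  assumes haar: "normalized_haar_measure \<mu>" and gl: "unit_volume_form \<mu> \<omega>\<^sub>g\<^sub>l" and A: "unit_volume_form \<mu> \<omega>\<^sub>A"
    and \<gamma>: "charpoly \<gamma> = [:- a, 1:] * [:- b, 1:]" and ab: "a \<noteq> b" and \<rho>: "0 < \<rho>" "\<rho> \<le> 1"
    and form: "form_measure \<mu> (char_fiber \<gamma>) (quotient_form char_map \<omega>\<^sub>g\<^sub>l \<omega>\<^sub>A) \<nu>"
  shows "eigenline_chart a b r ` eigenline_box \<rho> \<in> sets \<nu>"
    and "emeasure \<nu> (eigenline_chart a b r ` eigenline_box \<rho>) = emeasure \<mu> {s. absval s \<le> \<rho>}"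
proof -
  let ?\<psi> = "eigenline_chart a b r" and ?V = "eigenline_box \<rho> :: ('a ^ 2) set"
  have chart: "chart_on (char_fiber \<gamma>) ?V ?\<psi>"
    using ab \<rho> \<gamma> by (rule chart_on_eigenline_chart)
  then obtain T where "open T" "?\<psi> ` ?V = char_fiber \<gamma> \<inter> T"
    by (auto simp: chart_on_def openin_open)
  then show sets: "?\<psi> ` ?V \<in> sets \<nu>"
    using form by (auto simp: form_measure_def sets_restrict_space)
  have cball: "{s. absval s \<le> \<rho>} = cball (0::'a) \<rho>"
    by (auto simp: dist_absval)
  have borel: "{s :: 'a. absval s \<le> \<rho>} \<in> sets borel" "(ring_of_integers :: 'a set) \<in> sets borel"
    unfolding cball using closed_ring_of_integers by (auto intro: borel_closed)
  define B where "B i = (if i = 1 then {s. absval s \<le> \<rho>} else (ring_of_integers :: 'a set))" for i :: 2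
  have B: "B i \<in> sets borel" for i
    using borel by (simp add: B_def)
  have V: "?V = {t. \<forall>i. t $ i \<in> B i}"
    by (auto simp: eigenline_box_def B_def forall_2 ring_of_integers_iff)
  have "emeasure \<nu> (?\<psi> ` ?V) = (\<integral>\<^sup>+t\<in>{t\<in>?V. ?\<psi> t \<in> ?\<psi> ` ?V}. ennreal (absval
      (quotient_form char_map \<omega>\<^sub>g\<^sub>l \<omega>\<^sub>A (?\<psi> t) (\<lambda>j. column j (jacobian ?\<psi> t)))) \<partial>coordinate_measure \<mu>)"
    using form chart sets unfolding form_measure_def by blast
  also have "\<dots> = (\<integral>\<^sup>+t. indicator ?V t \<partial>coordinate_measure \<mu>)"
    using absval_quotient_form_eigenline[OF haar gl A ab]
    by (intro nn_integral_cong) (auto simp: indicator_def)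
  also have "\<dots> = emeasure (coordinate_measure \<mu>) ?V"
    using emeasure_coordinate_box(1)[OF haar B] unfolding V
    by (intro nn_integral_indicator) (simp add: coordinate_measure_def)
  also have "\<dots> = (\<Prod>i\<in>UNIV. emeasure \<mu> (B i))"
    unfolding V by (rule emeasure_coordinate_box(2)[OF haar B])
  also have "\<dots> = emeasure \<mu> {s. absval s \<le> \<rho>}"
    by (simp add: UNIV_2 B_def emeasure_ring_of_integers[OF haar])
  finally show "emeasure \<nu> (?\<psi> ` ?V) = emeasure \<mu> {s. absval s \<le> \<rho>}" .
qed


section \<open>Integral points of the fibre\<close>

lemma eigenline_chart_relations:
  assumes "x = eigenline_chart a b r t"
  shows "x $ (r + 1, r) = t $ 1 * (x $ (r, r) - b)"
    and "x $ (r + 1, r + 1) - b = t $ 1 * x $ (r, r + 1)"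
    and "x $ (r, r) - b = (a - b) - t $ 1 * x $ (r, r + 1)"
  unfolding assms eigenline_chart_simps by (simp_all add: algebra_simps power2_eq_square)

lemma add_1_add_1: "r + 1 + 1 = r" for r :: 2
  using range_2[of "r + 1 + 1" r] by auto

text \<open>At a common point the two parameters would describe the same line, forcing s s' = 1. As
  |s s'| < 1, the factor 1 - s s' is invertible, so the row of X - b with index \<open>r\<close>
  vanishes, which contradicts \<open>a \<noteq> b\<close>.\<close>

lemma eigenline_charts_disjoint:
  fixes a b :: "'a::nonarch_local_field"
  assumes ab: "a \<noteq> b" and \<rho>: "\<rho> < 1"
  shows "eigenline_chart a b r ` eigenline_box 1 \<inter> eigenline_chart a b (r + 1) ` eigenline_box \<rho> = {}"
proof (rule ccontr)
  assume "eigenline_chart a b r ` eigenline_box 1 \<inter> eigenline_chart a b (r + 1) ` eigenline_box \<rho> \<noteq> {}"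
  then obtain x t t' where t: "t \<in> eigenline_box 1" "x = eigenline_chart a b r t"
    and t': "t' \<in> eigenline_box \<rho>" "x = eigenline_chart a b (r + 1) t'"
    by blast
  have rel: "x $ (r + 1, r) = t $ 1 * (x $ (r, r) - b)"
    "x $ (r + 1, r + 1) - b = t $ 1 * x $ (r, r + 1)"
    "x $ (r, r) - b = (a - b) - t $ 1 * x $ (r, r + 1)"
    "x $ (r, r + 1) = t' $ 1 * (x $ (r + 1, r + 1) - b)"
    "x $ (r, r) - b = t' $ 1 * x $ (r + 1, r)"
    using eigenline_chart_relations[OF t(2)] eigenline_chart_relations[OF t'(2)]
    by (simp_all only: add_1_add_1)
  have "absval (t' $ 1) * absval (t $ 1) \<le> absval (t' $ 1) * 1"
    using t(1) by (intro mult_left_mono) (auto simp: eigenline_box_def)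
  then have "absval (t' $ 1 * t $ 1) < 1"
    using t'(1) \<rho> by (simp add: absval_mult eigenline_box_def)
  then have ne: "1 - t' $ 1 * t $ 1 \<noteq> 0" by auto
  have "(1 - t' $ 1 * t $ 1) * x $ (r, r + 1) = 0"
    using rel(2,4) by (simp add: left_diff_distrib mult.assoc)
  moreover have "(1 - t' $ 1 * t $ 1) * (x $ (r, r) - b) = 0"
    using rel(1,5) by (simp add: left_diff_distrib mult.assoc)
  ultimately have "x $ (r, r + 1) = 0" "x $ (r, r) - b = 0"
    using ne by (metis mult_eq_0_iff)+
  with rel(3) ab show False by simp
qed

text \<open>Discreteness of the valuation, applied to x / y, sharpens a strict inequality by the
  factor 1/q. When the domination required by one chart fails, this yields the domination with
  radius 1/q required by the other.\<close>

lemma absval_less_imp_le: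
  "absval x < absval y \<Longrightarrow> absval x \<le> inverse (real (card (residue_field :: 'a set set))) * absval y"
  for x y :: "'a::nonarch_local_field"
proof -
  assume less: "absval x < absval y"
  then have y: "absval y > 0" using absval_nonneg[of x] by linarith
  then have "x / y \<in> maximal_ideal"
    using less by (simp add: maximal_ideal_iff_less absval_divide del: absval_pos)
  then show ?thesis
    using y by (simp add: maximal_ideal_iff absval_divide pos_divide_le_eq del: absval_pos)
qed

text \<open>In a nonzero column of X - b either the upper entry dominates, which puts X into the
  first chart, or the lower one dominates strictly, which puts X into the second. Conversely the
  entries of the parametrization are integer polynomials in a, b, s and y, all of which are
  integral.\<close>

lemma integral_points_char_fiber:
  fixes a b :: "'a::nonarch_local_field"
  assumes \<gamma>: "charpoly \<gamma> = [:- a, 1:] * [:- b, 1:]" and ab: "a \<noteq> b"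
    and int: "absval a \<le> 1" "absval b \<le> 1"
  shows "char_fiber \<gamma> \<inter> integral_points =
    eigenline_chart a b r ` eigenline_box 1 \<union>
    eigenline_chart a b (r + 1) ` eigenline_box (inverse (real (card (residue_field :: 'a set set))))"
    (is "_ = ?A \<union> ?B")
proof (intro equalityI subsetI)
  let ?q = "inverse (real (card (residue_field :: 'a set set)))"
  have q: "0 < ?q" "?q \<le> 1"
    using card_residue_field_gt_1[where 'a='a] by (auto simp: inverse_le_1_iff)
  {
    fix x assume mem: "x \<in> char_fiber \<gamma> \<inter> integral_points"
    then have tr: "x $ (r, r) + x $ (r + 1, r + 1) = a + b"
      and det: "x $ (r, r) * x $ (r + 1, r + 1) - x $ (r, r + 1) * x $ (r + 1, r) = a * b"
      by (auto simp: char_fiber_eq[OF \<gamma>, of r])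
    have x: "absval (x $ p) \<le> 1" for p
      using mem by (simp add: integral_points_def ring_of_integers_iff del: split_paired_All)
    have sum: "(x $ (r, r) - b) + (x $ (r + 1, r + 1) - b) = a - b"
      using tr by (simp add: algebra_simps)
    have "(x $ (r, r) - b \<noteq> 0 \<and> absval (x $ (r + 1, r)) \<le> 1 * absval (x $ (r, r) - b) \<or>
        x $ (r, r + 1) \<noteq> 0 \<and> absval (x $ (r + 1, r + 1) - b) \<le> 1 * absval (x $ (r, r + 1))) \<or>
      (x $ (r + 1, r + 1) - b \<noteq> 0 \<and> absval (x $ (r, r + 1)) \<le> ?q * absval (x $ (r + 1, r + 1) - b) \<or>
        x $ (r + 1, r) \<noteq> 0 \<and> absval (x $ (r, r) - b) \<le> ?q * absval (x $ (r + 1, r)))"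
      (is "?left \<or> ?right")
    \<comment> \<open>Column \<open>r\<close> decides unless it is zero; in that case the trace
      makes the lower entry of the other column equal to \<open>a - b\<close>, which is nonzero, and
      the other column decides.\<close>
    proof (cases "absval (x $ (r, r) - b) < absval (x $ (r + 1, r))")
      case True
      then show ?thesis using absval_less_imp_le by fastforce
    next
      case False
      show ?thesis
      proof (cases "x $ (r, r) - b = 0")
        case True
        then have "x $ (r + 1, r + 1) - b \<noteq> 0" using sum ab by auto
        then show ?thesis
          using absval_less_imp_le[of "x $ (r, r + 1)" "x $ (r + 1, r + 1) - b"]
          by (cases "absval (x $ (r, r + 1)) < absval (x $ (r + 1, r + 1) - b)") auto
      qed (use False in auto)
    qed
    then show "x \<in> ?A \<union> ?B"
    proof
      assume ?left
      then have "x \<in> ?A"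
        unfolding eigenline_chart_image[OF ab zero_less_one order_refl] mem_Collect_eq
        using tr det x by blast
      then show ?thesis ..
    next
      assume ?right
      moreover have "x $ (r + 1, r + 1) + x $ (r, r) = a + b"
        "x $ (r + 1, r + 1) * x $ (r, r) - x $ (r + 1, r) * x $ (r, r + 1) = a * b"
        using tr det by (simp_all add: algebra_simps)
      ultimately have "x \<in> ?B"
        unfolding eigenline_chart_image[OF ab q] mem_Collect_eq add_1_add_1
        using x by blast
      then show ?thesis ..
    qed
  }
  have integral: "eigenline_chart a b k t \<in> char_fiber \<gamma> \<inter> integral_points"
    if "t \<in> eigenline_box \<rho>" "\<rho> \<le> 1" for k t \<rho>
  proof -
    have t: "absval (t $ 1) \<le> 1" "absval (t $ 2) \<le> 1"
      using that by (auto simp: eigenline_box_def)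
    have mult: "absval (c * d) \<le> 1" if "absval c \<le> 1" "absval d \<le> 1" for c d :: 'a
      using that by (simp add: absval_mult mult_le_one)
    have "\<forall>p. absval (eigenline_chart a b k t $ p) \<le> 1"
      unfolding forall_2x2[of _ k] eigenline_chart_simps power2_eq_square
      using t int by (intro conjI absval_add_le absval_diff_le mult) auto
    moreover have "eigenline_chart a b k t \<in> char_fiber \<gamma>"
      unfolding char_fiber_eq[OF \<gamma>, of k] mem_Collect_eq eigenline_chart_simps
      by (simp add: algebra_simps power2_eq_square)
    ultimately show ?thesis
      by (simp add: integral_points_def ring_of_integers_iff)
  qed
  fix x assume "x \<in> ?A \<union> ?B"
  then show "x \<in> char_fiber \<gamma> \<inter> integral_points"
    using integral[of _ 1 r] integral[of _ ?q "r + 1"] q by blast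
qed

text \<open>A monic quadratic polynomial is determined by the two coefficients recorded in
  \<open>char_map\<close>, so prescribing the characteristic polynomial is the same as lying in the
  fibre.\<close>

lemma matrix_point_image:
  "matrix_point ` {X \<in> integral_matrices. charpoly X = charpoly \<gamma>} = char_fiber \<gamma> \<inter> integral_points"
  for \<gamma> :: "'a::discretely_valued_field ^ 2 ^ 2"
proof -
  have inv: "point_matrix (matrix_point X) = X" for X :: "'a ^ 2 ^ 2"
    by (simp add: point_matrix_def matrix_point_def vec_eq_iff)
  have inv': "matrix_point (point_matrix x) = x" for x :: "'a ^ (2 \<times> 2)"
    by (simp add: point_matrix_def matrix_point_def vec_eq_iff)
  have "matrix_point X \<in> char_fiber \<gamma> \<longleftrightarrow> charpoly X = charpoly \<gamma>" for X
    unfolding char_fiber_def mem_Collect_eq char_map_def inv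
    by (auto simp: charpoly_2[of _ 1] vec_eq_iff forall_2)
  moreover have "matrix_point X \<in> integral_points \<longleftrightarrow> X \<in> integral_matrices" for X :: "'a ^ 2 ^ 2"
    by (simp add: matrix_point_def integral_points_def integral_matrices_def)
  ultimately show ?thesis
    by (auto simp: image_iff) (metis inv')
qed

text \<open>Integral closedness for quadratics: if |a| > 1, the product forces |b| \<le> 1, and then
  a = (a + b) - b is integral after all.\<close>

lemma absval_root_le_1:
  fixes a b :: "'a::nonarch_local_field"
  assumes "absval (a + b) \<le> 1" "absval (a * b) \<le> 1"
  shows "absval a \<le> 1"
proof (rule ccontr)
  assume a: "\<not> absval a \<le> 1"
  have "absval b \<le> 1"
  proof (rule ccontr)
    assume "\<not> absval b \<le> 1"
    then have "1 < absval a * absval b" using a by (simp add: less_1_mult)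
    with assms(2) show False by (simp add: absval_mult)
  qed
  with a absval_diff_le[OF assms(1), of b] show False by simp
qed

theorem theorem5p5:
  fixes \<gamma> :: "'a::nonarch_local_field ^ 2 ^ 2"
    and \<mu> :: "'a measure"
    and \<omega>\<^sub>g\<^sub>l :: "(2 + 2 \<Rightarrow> 'a ^ (2 \<times> 2)) \<Rightarrow> 'a"
    and \<omega>\<^sub>A :: "(2 \<Rightarrow> 'a ^ 2) \<Rightarrow> 'a"
    and \<nu> :: "('a ^ (2 \<times> 2)) measure"
  assumes "CHAR('a) = 0 \<or> CHAR('a) > 2"
    and "normalized_haar_measure \<mu>"
    and "unit_volume_form \<mu> \<omega>\<^sub>g\<^sub>l"
    and "unit_volume_form \<mu> \<omega>\<^sub>A"
    and "\<gamma> \<in> integral_matrices"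
    and "hyperbolic_regular_semisimple \<gamma>"
    and "form_measure \<mu> (char_fiber \<gamma>) (quotient_form char_map \<omega>\<^sub>g\<^sub>l \<omega>\<^sub>A) \<nu>"
  shows "stable_orbital_integral \<nu> \<gamma> =
    ennreal ((real (card (residue_field :: 'a set set)) + 1) / real (card (residue_field :: 'a set set)))"
proof -
  note haar = assms(2)
  let ?q = "real (card (residue_field :: 'a set set))"
  have q: "0 < inverse ?q" "inverse ?q < 1" "?q > 0"
    using card_residue_field_gt_1[where 'a='a] by (auto simp: inverse_less_1_iff)
  obtain a b where ab: "a \<noteq> b" and \<gamma>: "charpoly \<gamma> = [:- a, 1:] * [:- b, 1:]"
    using assms(6) by (auto simp: hyperbolic_regular_semisimple_def)
  have \<gamma>_le: "absval (\<gamma> $ i $ j) \<le> 1" for i j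
    using assms(5) by (simp add: integral_matrices_def ring_of_integers_iff)
  \<comment> \<open>Vieta's formulas: integrality of the trace and the determinant of
    \<open>\<gamma>\<close> is to be passed on to the eigenvalues.\<close>
  have "a + b = \<gamma> $ 1 $ 1 + \<gamma> $ (1 + 1) $ (1 + 1)"
    "a * b = \<gamma> $ 1 $ 1 * \<gamma> $ (1 + 1) $ (1 + 1) - \<gamma> $ 1 $ (1 + 1) * \<gamma> $ (1 + 1) $ 1"
    using \<gamma> unfolding charpoly_2[of _ 1] by (simp_all add: algebra_simps)
  moreover have "absval (\<gamma> $ i $ j * \<gamma> $ k $ l) \<le> 1" for i j k l
    using \<gamma>_le by (simp add: absval_mult mult_le_one)
  ultimately have coeffs: "absval (a + b) \<le> 1" "absval (a * b) \<le> 1"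
    using \<gamma>_le by (simp_all only: absval_add_le absval_diff_le)
  then have int: "absval a \<le> 1" "absval b \<le> 1"
    using absval_root_le_1[of a b] absval_root_le_1[of b a] by (simp_all add: ac_simps)
  let ?A = "eigenline_chart a b 1 ` eigenline_box 1"
  let ?B = "eigenline_chart a b (1 + 1) ` eigenline_box (inverse ?q)"
  \<comment> \<open>The two radii were chosen so that the first sides of the boxes are the ring of
    integers and the maximal ideal, whose measures are known.\<close>
  have balls: "{s :: 'a. absval s \<le> 1} = ring_of_integers" "{s :: 'a. absval s \<le> inverse ?q} = maximal_ideal"
    by (auto simp: ring_of_integers_iff maximal_ideal_iff)
  note image = emeasure_eigenline_chart_image[OF haar assms(3,4) \<gamma> ab _ _ assms(7)]
  have A: "?A \<in> sets \<nu>" "emeasure \<nu> ?A = 1"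
    using image[OF zero_less_one order_refl, of 1] emeasure_ring_of_integers[OF haar]
    unfolding balls by (simp_all only:)
  have B: "?B \<in> sets \<nu>" "emeasure \<nu> ?B = ennreal (inverse ?q)"
    using image[OF q(1) less_imp_le[OF q(2)], of "1 + 1"] emeasure_maximal_ideal[OF haar]
    unfolding balls by (simp_all only:)
  have "stable_orbital_integral \<nu> \<gamma> = (\<integral>\<^sup>+x. indicator (?A \<union> ?B) x \<partial>\<nu>)"
    unfolding stable_orbital_integral_def matrix_point_image
      integral_points_char_fiber[OF \<gamma> ab int, of 1] by simp
  also have "\<dots> = emeasure \<nu> (?A \<union> ?B)"
    using A B by (intro nn_integral_indicator) auto
  also have "\<dots> = emeasure \<nu> ?A + emeasure \<nu> ?B"
    using A B eigenline_charts_disjoint[OF ab q(2)] by (intro plus_emeasure[symmetric])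
  also have "\<dots> = ennreal (1 + inverse ?q)"
    using A B q by (simp add: ennreal_plus)
  also have "1 + inverse ?q = (?q + 1) / ?q"
    using q by (simp add: field_simps)
  finally show ?thesis .
qed

end
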